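(* Let $m\geq0$ and $n\geq1$ be integers, let $N$ be an even integer with $N\ge n+m-1$, and let $A$ be an $(n+N)\times(n+N)$ skew-symmetric matrix indexed by $[n+N]$. Let \[ D_{n,m}(A,t,u)=\sum_{I\in\binom{[n+N]}{n}}(-1)^{s(\overline I,I)}\operatorname{Pf}\big(A^{\overline I}_{\overline I}\big)\det\big(B^N_{n,m}(t,u)_I\big), \] and let $C_{n,m}(A,t,u)$ be the constant term in $z_1,\dots,z_n$ of \[ \prod_{1\le i<j\le n}\Big(1-\frac{z_j}{z_i}\Big)\prod_{k=1}^{n}h^{(m)}_{n-k}(z_k^{-1},t,u)\,F_A(z_1,\dots,z_n). \] Then $D_{n,m}(A,t,u)=C_{n,m}(A,t,u)$.
   Context: $\overline I=[n+N]\setminus I$; $s(\overline I,I)$ is the number of pairs $(a,b)$ with $a\in\overline I$, $b\in I$, $a>b$; $A^K_K$ is the principal submatrix on $K$. $B^N_{n,m}(t,u)=(b_{ij})_{0\le i\le n-1,\,0\le j\le n+N-1}$ with $b_{ij}=\delta_{0,j}$ if $i+m=0$; $b_{ij}=\binom{i+m-1}{j-i}+\binom{i+m-1}{j-i-1}tu$ if $i+m=1$; otherwise $b_{ij}=\binom{i+m-2}{j-i}+\binom{i+m-2}{j-i-1}(t+u)+\binom{i+m-2}{j-i-2}tu$; its columns are identified with $[n+N]$ via $j\mapsto j+1$, and $B_I$ is the $n\times n$ submatrix on the columns in $I$. $h^{(m)}_i(z,t,u)$ equals $1$ if $m+i=0$, $(1+tuz)$ if $m+i=1$, and $(1+z)^{m+i-2}(1+tz)(1+uz)$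 otherwise. With $T$ the $n\times(n+N)$ matrix $T_{ij}=z_i^{j-1}$, $O_n$ the zero matrix and $J_n=(\delta_{i,n+1-j})$, $G_A(z_1,\dots,z_n)=\operatorname{Pf}\begin{pmatrix}O_n&J_nT\\-{}^tTJ_n&A\end{pmatrix}$ is antisymmetric in the $z_i$, and $F_A$ is the symmetric polynomial with $G_A=F_A\prod_{1\le i<j\le n}(z_j-z_i)$. $\operatorname{Pf}$ is the Pfaffian. *)

theory Defs
  imports
    "Jordan_Normal_Form.Determinant"
    "Jordan_Normal_Form.DL_Submatrix"
    "HOL-Library.Poly_Mapping"
begin

text \<open>
  Matrices are those of \<^theory>\<open>Jordan_Normal_Form.Matrix\<close>, whose rows and columns are counted
  from 0. The index set $[n+N]$ is therefore rendered as \<open>{..<n + N}\<close>, that is, shifted by one;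
  neither principal submatrices nor the number of inversions between two index sets depend on
  this shift, and it is the shift by which the columns of \<open>B\<close> are identified with $[n+N]$.
\<close>

subsection \<open>Pfaffians\<close>

text \<open>
  A perfect matching of \<open>{..<2 * k}\<close> is written uniquely as
  $\{\{p_0,p_1\},\{p_2,p_3\},\dots\}$ with $p_{2i} < p_{2i+1}$ and $p_0 < p_2 < \dots$, so that
  perfect matchings are certain permutations.
\<close>

definition perfect_matchings :: "nat \<Rightarrow> (nat \<Rightarrow> nat) set" where
  "perfect_matchings k = {p. p permutes {0..<2 * k} \<and>
     (\<forall>i<k. p (2 * i) < p (2 * i + 1)) \<and>
     (\<forall>i j. i < j \<and> j < k \<longrightarrow> p (2 * i) < p (2 * j))}"

definition Pf :: "'a::comm_ring_1 mat \<Rightarrow> 'a" where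
  "Pf M = (if odd (dim_row M) then 0 else
     (\<Sum>p\<in>perfect_matchings (dim_row M div 2).
        signof p * (\<Prod>i<dim_row M div 2. M $$ (p (2 * i), p (2 * i + 1)))))"

subsection \<open>The sum of products of Pfaffians and minors\<close>

definition inv_pairs :: "nat set \<Rightarrow> nat set \<Rightarrow> nat" where
  "inv_pairs K I = card {(a, b). a \<in> K \<and> b \<in> I \<and> a > b}"

text \<open>The lower argument of the binomial coefficients may be negative.\<close>

definition binom :: "nat \<Rightarrow> int \<Rightarrow> 'a::comm_ring_1" where
  "binom a k = (if k < 0 then 0 else of_nat (a choose nat k))"

definition b_entry :: "nat \<Rightarrow> 'a::comm_ring_1 \<Rightarrow> 'a \<Rightarrow> nat \<Rightarrow> nat \<Rightarrow> 'a" where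
  "b_entry m t u i j =
    (if i + m = 0 then (if j = 0 then 1 else 0)
     else if i + m = 1 then
       binom (i + m - 1) (int j - int i) + binom (i + m - 1) (int j - int i - 1) * (t * u)
     else
       binom (i + m - 2) (int j - int i)
       + binom (i + m - 2) (int j - int i - 1) * (t + u)
       + binom (i + m - 2) (int j - int i - 2) * (t * u))"

definition B_mat :: "nat \<Rightarrow> nat \<Rightarrow> nat \<Rightarrow> 'a::comm_ring_1 \<Rightarrow> 'a \<Rightarrow> 'a mat" where
  "B_mat N n m t u = mat n (n + N) (\<lambda>(i, j). b_entry m t u i j)"

definition D_sum :: "nat \<Rightarrow> nat \<Rightarrow> nat \<Rightarrow> 'a::comm_ring_1 mat \<Rightarrow> 'a \<Rightarrow> 'a \<Rightarrow> 'a" where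
  "D_sum N n m A t u =
    (\<Sum>I | I \<subseteq> {..<n + N} \<and> card I = n.
       (-1) ^ inv_pairs ({..<n + N} - I) I
       * Pf (submatrix A ({..<n + N} - I) ({..<n + N} - I))
       * det (submatrix (B_mat N n m t u) UNIV I))"

subsection \<open>Laurent polynomials\<close>

text \<open>
  Laurent polynomials in the variables $z_1, z_2, \dots$: finitely supported functions from
  finitely supported integer exponent vectors to the coefficients.
\<close>

type_synonym 'a laurent = "(nat \<Rightarrow>\<^sub>0 int) \<Rightarrow>\<^sub>0 'a"

definition lconst :: "'a::comm_ring_1 \<Rightarrow> 'a laurent" where
  "lconst c = Poly_Mapping.single 0 c"

definition zpow :: "nat \<Rightarrow> int \<Rightarrow> 'a::comm_ring_1 laurent" where
  "zpow i e = Poly_Mapping.single (Poly_Mapping.single i e) 1"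

abbreviation zvar :: "nat \<Rightarrow> 'a::comm_ring_1 laurent" where
  "zvar i \<equiv> zpow i 1"

abbreviation zinv :: "nat \<Rightarrow> 'a::comm_ring_1 laurent" where
  "zinv i \<equiv> zpow i (-1)"

definition constant_term :: "'a::comm_ring_1 laurent \<Rightarrow> 'a" where
  "constant_term p = Poly_Mapping.lookup p 0"

definition is_polynomial :: "nat \<Rightarrow> 'a::comm_ring_1 laurent \<Rightarrow> bool" where
  "is_polynomial n p \<longleftrightarrow>
    (\<forall>\<alpha>\<in>Poly_Mapping.keys p. Poly_Mapping.keys \<alpha> \<subseteq> {1..n} \<and>
       (\<forall>i. Poly_Mapping.lookup \<alpha> i \<ge> 0))"

text \<open>
  \<open>Poly_Mapping.map_key \<pi> \<alpha>\<close> is the exponent vector \<open>\<alpha> \<circ> \<pi>\<close>.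
\<close>

definition is_symmetric :: "nat \<Rightarrow> 'a::comm_ring_1 laurent \<Rightarrow> bool" where
  "is_symmetric n p \<longleftrightarrow>
    (\<forall>\<pi>. \<pi> permutes {1..n} \<longrightarrow>
       (\<forall>\<alpha>. Poly_Mapping.lookup p (Poly_Mapping.map_key \<pi> \<alpha>) = Poly_Mapping.lookup p \<alpha>))"

subsection \<open>The constant term\<close>

definition T_mat :: "nat \<Rightarrow> nat \<Rightarrow> 'a::comm_ring_1 laurent mat" where
  "T_mat n N = mat n (n + N) (\<lambda>(i, j). zvar (i + 1) ^ j)"

definition J_mat :: "nat \<Rightarrow> 'a::comm_ring_1 mat" where
  "J_mat n = mat n n (\<lambda>(i, j). if i + 1 = n + 1 - (j + 1) then 1 else 0)"

definition G_poly :: "nat \<Rightarrow> nat \<Rightarrow> 'a::comm_ring_1 mat \<Rightarrow> 'a laurent" where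
  "G_poly n N A = Pf (four_block_mat
     (0\<^sub>m n n)                                (J_mat n * T_mat n N)
     (- (transpose_mat (T_mat n N) * J_mat n)) (map_mat lconst A))"

text \<open>
  The product of the differences is not a zero divisor, over any commutative ring, and it divides
  every alternating polynomial, so there is exactly one such \<open>F\<close>.
\<close>

definition F_poly :: "nat \<Rightarrow> nat \<Rightarrow> 'a::comm_ring_1 mat \<Rightarrow> 'a laurent" where
  "F_poly n N A = (THE F. is_polynomial n F \<and> is_symmetric n F \<and>
     G_poly n N A = F * (\<Prod>(i, j)\<in>{(i, j). 1 \<le> i \<and> i < j \<and> j \<le> n}. zvar j - zvar i))"

definition h_factor :: "nat \<Rightarrow> nat \<Rightarrow> 'b::comm_ring_1 \<Rightarrow> 'b \<Rightarrow> 'b \<Rightarrow> 'b" where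
  "h_factor m i z t u =
    (if m + i = 0 then 1
     else if m + i = 1 then 1 + t * u * z
     else (1 + z) ^ (m + i - 2) * (1 + t * z) * (1 + u * z))"

definition C_term :: "nat \<Rightarrow> nat \<Rightarrow> nat \<Rightarrow> 'a::comm_ring_1 mat \<Rightarrow> 'a \<Rightarrow> 'a \<Rightarrow> 'a" where
  "C_term N n m A t u = constant_term
    ((\<Prod>(i, j)\<in>{(i, j). 1 \<le> i \<and> i < j \<and> j \<le> n}. 1 - zvar j * zinv i)
     * (\<Prod>k = 1..n. h_factor m (n - k) (zinv k) (lconst t) (lconst u))
     * F_poly n N A)"

end

theory Submission
  imports Defs
begin

text \<open>
  Expanding the Pfaffian along its zero block writes \<open>G\<close> as a signed sum, over the \<open>n\<close>-subsets \<open>I\<close>,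
  of \<open>Pf\<close> of the principal submatrix of \<open>A\<close> on the complement of \<open>I\<close> times the generalized
  Vandermonde determinant with the exponents in \<open>I\<close>. Newton interpolation at the points \<open>z\<^sub>i\<close> factors
  each of these as the product of the differences times the determinant of a matrix of polynomials,
  which gives \<open>F\<close>; its symmetry and uniqueness follow because the differences can be cancelled.
  On the other hand \<open>\<Prod>(1 - z\<^sub>j / z\<^sub>i)\<close> is, up to sign, the product of the differences times
  \<open>\<Prod>z\<^sub>k\<close> to the power \<open>k - n\<close>. So the constant term only involves \<open>G\<close> and a product of functions of
  a single variable, and in the Leibniz expansion of the generalized Vandermonde determinant it
  factors into entries of \<open>B\<close>. All signs that arise from reversing rows occur in pairs and cancel.
\<close>

subsection \<open>Newton interpolation and inversions\<close>

text \<open>The coefficient of x^j at the Newton basis polynomial N_r(x) = (x - z_0)...(x -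
  z_{r-1}), that is, the complete homogeneous symmetric polynomial of degree j - r in z_0, ..., z_r.
  The recursion comes from x N_r = N_{r+1} + z_r N_r, so no division by differences of nodes
  occurs.\<close>

fun newton_coeff :: "(nat \<Rightarrow> 'a::comm_ring_1) \<Rightarrow> nat \<Rightarrow> nat \<Rightarrow> 'a" where
  "newton_coeff z r 0 = (if r = 0 then 1 else 0)"
| "newton_coeff z r (Suc j) =
    (case r of 0 \<Rightarrow> 0 | Suc r' \<Rightarrow> newton_coeff z r' j) + z r * newton_coeff z r j"

lemma newton_coeff_eq_0: "j < r \<Longrightarrow> newton_coeff z r j = 0"
  by (induction j arbitrary: r) (auto split: nat.split)

lemma newton_coeff_diag: "newton_coeff z r r = 1"
  by (induction r) (auto simp: newton_coeff_eq_0)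

text \<open>Multiplying the expansion of x^j by x and using x N_r = N_{r+1} + z_r N_r gives that of
  x^(j+1). The sum can stop below n for every j because the first hypothesis says N_n(x) =
  0.\<close>

lemma power_newton_expansion:
  fixes x :: "'a::comm_ring_1"
  assumes "(\<Prod>k<n. x - z k) = 0" "n > 0"
  shows "(\<Sum>r<n. (\<Prod>k<r. x - z k) * newton_coeff z r j) = x ^ j"
proof (induction j)
  case 0
  have "(\<Sum>r<n. (\<Prod>k<r. x - z k) * newton_coeff z r 0) = (\<Sum>r<n. if r = 0 then 1 else 0)"
    by (intro sum.cong) auto
  then show ?case using assms by simp
next
  case (Suc j)
  let ?N = "\<lambda>r. \<Prod>k<r. x - z k" and ?c = "newton_coeff z"
  obtain m where m: "n = Suc m" using assms by (cases n) auto
  have "(\<Sum>r<n. ?N r * ?c r (Suc j))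
      = (\<Sum>r<n. ?N r * (case r of 0 \<Rightarrow> 0 | Suc r' \<Rightarrow> ?c r' j)) + (\<Sum>r<n. z r * (?N r * ?c r j))"
    by (simp add: sum.distrib algebra_simps)
  also have "(\<Sum>r<n. ?N r * (case r of 0 \<Rightarrow> 0 | Suc r' \<Rightarrow> ?c r' j)) = (\<Sum>r<m. ?N (Suc r) * ?c r j)"
    unfolding m by (subst sum.lessThan_Suc_shift) (simp del: prod.lessThan_Suc)
  \<comment> \<open>The added term r = m carries the factor N_n, which vanishes by
    hypothesis.\<close>
  also have "\<dots> = (\<Sum>r<n. ?N (Suc r) * ?c r j)"
    using assms(1) unfolding m by simp
  finally have "(\<Sum>r<n. ?N r * ?c r (Suc j)) = (\<Sum>r<n. ?N (Suc r) * ?c r j + z r * (?N r * ?c r j))"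
    by (simp add: sum.distrib)
  also have "\<dots> = x * (\<Sum>r<n. ?N r * ?c r j)"
    by (simp add: sum_distrib_left algebra_simps)
  finally show ?case using Suc.IH by simp
qed

definition diff_prod :: "nat \<Rightarrow> (nat \<Rightarrow> 'a::comm_ring_1) \<Rightarrow> 'a" where
  "diff_prod n z = (\<Prod>i<n. \<Prod>k<i. z i - z k)"

text \<open>Newton interpolation factors the matrix of powers as a lower triangular matrix, with the
  products N_r(z_i) as entries, times the matrix of Newton coefficients. The quotient of a
  generalized Vandermonde determinant by the product of differences is thus given explicitly, over
  any commutative ring; for increasing \<open>f\<close> it is a Schur polynomial.\<close>

lemma det_powers:
  fixes z :: "nat \<Rightarrow> 'a::comm_ring_1"
  shows "det (mat n n (\<lambda>(i, j). z i ^ f j))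
    = diff_prod n z * det (mat n n (\<lambda>(r, j). newton_coeff z r (f j)))"
proof -
  let ?L = "mat n n (\<lambda>(i, r). \<Prod>k<r. z i - z k)"
    and ?H = "mat n n (\<lambda>(r, j). newton_coeff z r (f j))"
  have "mat n n (\<lambda>(i, j). z i ^ f j) = ?L * ?H"
  proof (rule eq_matI)
    fix i j assume ij: "i < dim_row (?L * ?H)" "j < dim_col (?L * ?H)"
    \<comment> \<open>The factor with k = i vanishes, so the Newton expansion at the node z_i is
      exact.\<close>
    then have "(\<Prod>k<n. z i - z k) = 0" by (auto intro!: prod_zero)
    then have "(\<Sum>r<n. (\<Prod>k<r. z i - z k) * newton_coeff z r (f j)) = z i ^ f j"
      using ij by (intro power_newton_expansion) auto
    then show "mat n n (\<lambda>(i, j). z i ^ f j) $$ (i, j) = (?L * ?H) $$ (i, j)"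
      using ij by (simp add: scalar_prod_def lessThan_atLeast0)
  qed auto
  moreover have "det ?L = diff_prod n z"
  proof -
    have "det ?L = prod_list (diag_mat ?L)"
      by (rule det_lower_triangular[of n]) (auto intro!: prod_zero)
    then show ?thesis
      by (simp add: prod_list_diag_prod diff_prod_def lessThan_atLeast0)
  qed
  ultimately show ?thesis by (simp add: det_mult[of _ n])
qed

text \<open>For the exponents 0, ..., n - 1 the matrix of Newton coefficients is upper
  unitriangular.\<close>

lemma det_vandermonde:
  fixes z :: "nat \<Rightarrow> 'a::comm_ring_1"
  shows "det (mat n n (\<lambda>(i, j). z i ^ j)) = diff_prod n z"
proof -
  let ?H = "mat n n (\<lambda>(r, j). newton_coeff z r j)"
  have "det ?H = prod_list (diag_mat ?H)"
    by (rule det_upper_triangular[of _ n]) (auto simp: newton_coeff_eq_0)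
  then show ?thesis
    using det_powers[of n z id] by (simp add: prod_list_diag_prod newton_coeff_diag)
qed

section \<open>Signs of permutations by counting inversions\<close>

text \<open>Pairs of positions, the smaller one first. No bound on the positions is imposed, so the
  set does not depend on an ambient interval; \<open>inversions_bound\<close> supplies one.\<close>

definition inversions :: "(nat \<Rightarrow> nat) \<Rightarrow> (nat \<times> nat) set" where
  "inversions p = {(k, i). k < i \<and> p i < p k}"

lemma prod_signs: "finite S \<Longrightarrow> (\<Prod>x\<in>S. if P x then - 1 else 1) = (- 1 :: 'a::comm_ring_1) ^ card {x\<in>S. P x}"
  by (simp add: prod.If_cases Int_def)

lemma sgn_prod_int: "sgn (prod f S) = (\<Prod>x\<in>S. sgn (f x :: int))"
  by (induction S rule: infinite_finite_induct) (simp_all add: sgn_mult)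

lemma inversions_bound:
  assumes "p permutes {0..<n}" "(k, i) \<in> inversions p"
  shows "i < n"
proof (rule ccontr)
  assume "\<not> i < n"
  then have "p i = i" using assms by (simp add: permutes_not_in)
  moreover have "p k < n \<or> p k = k"
    using permutes_in_image[OF assms(1), of k] permutes_not_in[OF assms(1), of k] by force
  ultimately show False using assms(2) \<open>\<not> i < n\<close> by (auto simp: inversions_def)
qed

text \<open>Permuting the rows of the integer Vandermonde matrix with nodes 0, ..., n - 1 multiplies
  its determinant by the sign of \<open>p\<close>. The original determinant is positive, and each
  negative factor of the permuted one is an inversion.\<close>

lemma sign_eq_inversions:
  assumes p: "p permutes {0..<n}"
  shows "sign p = (- 1) ^ card (inversions p)"
proof -
  let ?S = "SIGMA i:{..<n}. {..<i}"
  have "diff_prod n (\<lambda>i. int (p i)) = sign p * diff_prod n int"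
  proof -
    have "mat n n (\<lambda>(i, j). int (p i) ^ j) = mat n n (\<lambda>(i, j). mat n n (\<lambda>(i, j). int i ^ j) $$ (p i, j))"
      using permutes_in_image[OF p] by (intro eq_matI) auto
    then show ?thesis
      using det_permute_rows[OF _ p, of "mat n n (\<lambda>(i, j). int i ^ j)"]
      by (simp flip: det_vandermonde)
  qed
  then have "sgn (diff_prod n (\<lambda>i. int (p i))) = sgn (sign p) * sgn (diff_prod n int)"
    by (simp add: sgn_mult)
  moreover have "sgn (diff_prod n int) = 1"
    unfolding diff_prod_def by (auto simp: sgn_1_pos intro!: prod_pos)
  moreover have "sgn (sign p) = sign p" by (simp add: sign_def)
  moreover have "sgn (diff_prod n (\<lambda>i. int (p i))) = (- 1) ^ card (inversions p)"
  proof -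
    have inj: "p i \<noteq> p k" if "k < i" for i k
      using permutes_inj[OF p] that by (metis injD nat_neq_iff)
    have "sgn (diff_prod n (\<lambda>i. int (p i))) = (\<Prod>i<n. \<Prod>k<i. sgn (int (p i) - int (p k)))"
      by (simp add: diff_prod_def sgn_prod_int)
    also have "\<dots> = (\<Prod>(i, k)\<in>?S. sgn (int (p i) - int (p k)))"
      by (simp add: prod.Sigma)
    also have "\<dots> = (\<Prod>x\<in>?S. if p (fst x) < p (snd x) then - 1 else 1)"
      
    proof (rule prod.cong)
      fix x assume "x \<in> ?S"
      then have "p (fst x) \<noteq> p (snd x)" using inj by auto
      then show "(case x of (i, k) \<Rightarrow> sgn (int (p i) - int (p k)))
          = (if p (fst x) < p (snd x) then - 1 else 1)"
        by (simp add: case_prod_beta sgn_if)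
    qed simp
    also have "\<dots> = (- 1) ^ card {x\<in>?S. p (fst x) < p (snd x)}"
      by (rule prod_signs) simp
    \<comment> \<open>\<open>?S\<close> lists the larger index first and \<open>inversions\<close>
      the smaller one, hence the swap.\<close>
    also have "card {x\<in>?S. p (fst x) < p (snd x)} = card (inversions p)"
    proof (rule bij_betw_same_card[of prod.swap])
      have "i < n" if "k < i" "p i < p k" for k i
        using inversions_bound[OF p, of k i] that by (simp add: inversions_def)
      then show "bij_betw prod.swap {x\<in>?S. p (fst x) < p (snd x)} (inversions p)"
        by (auto simp: bij_betw_def inj_on_def inversions_def image_iff)
    qed
    finally show ?thesis .
  qed
  ultimately show ?thesis by simp
qed

section \<open>Increasing enumerations, block permutations and shuffles\<close>

lemma bij_betw_pick:
  assumes "finite S"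
  shows "bij_betw (pick S) {0..<card S} S"
proof -
  have "inj_on (pick S) {0..<card S}"
    by (intro linorder_inj_onI) (force dest: pick_mono_le)+
  moreover have "pick S ` {0..<card S} \<subseteq> S" by (auto intro: pick_in_set_le)
  ultimately show ?thesis
    using assms by (simp add: bij_betw_def card_image card_subset_eq)
qed

lemma pick_less_iff: "i < card S \<Longrightarrow> j < card S \<Longrightarrow> pick S i < pick S j \<longleftrightarrow> i < j"
  using pick_mono_le[of j S i] pick_mono_le[of i S j] by (cases i j rule: linorder_cases) auto

definition shift_perm :: "nat \<Rightarrow> (nat \<Rightarrow> nat) \<Rightarrow> nat \<Rightarrow> nat" where
  "shift_perm s p = (\<lambda>i. if i < s then i else s + p (i - s))"

lemma shift_perm_less [simp]: "i < s \<Longrightarrow> shift_perm s p i = i"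
  and shift_perm_add [simp]: "shift_perm s p (s + i) = s + p i"
  by (simp_all add: shift_perm_def)

lemma shift_perm_permutes:
  assumes p: "p permutes {0..<m}"
  shows "shift_perm s p permutes {0..<s + m}"
proof (rule inj_imp_permutes)
  show "inj_on (shift_perm s p) {0..<s + m}"
    by (auto simp: inj_on_def shift_perm_def inj_eq[OF permutes_inj[OF p]] split: if_splits)
  show "shift_perm s p x \<in> {0..<s + m}" if "x \<in> {0..<s + m}" for x
    using that permutes_in_image[OF p, of "x - s"] by (auto simp: shift_perm_def)
  show "shift_perm s p x = x" if "x \<notin> {0..<s + m}" for x
    using that permutes_not_in[OF p, of "x - s"] by (auto simp: shift_perm_def)
qed simp

text \<open>Translation by \<open>s\<close> is a bijection between the inversions of
  \<open>p\<close> and those of the shifted permutation, since the fixed initial block takes part in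
  none.\<close>

lemma sign_shift_perm:
  assumes p: "p permutes {0..<m}"
  shows "sign (shift_perm s p) = sign p"
proof -
  have "(k, i) \<in> (\<lambda>(k, i). (s + k, s + i)) ` inversions p" if "(k, i) \<in> inversions (shift_perm s p)" for k i
    using that by (intro image_eqI[of _ _ "(k - s, i - s)"])
      (auto simp: inversions_def shift_perm_def split: if_splits)
  then have "bij_betw (\<lambda>(k, i). (s + k, s + i)) (inversions p) (inversions (shift_perm s p))"
    unfolding bij_betw_def inj_on_def by (auto simp: inversions_def)
  then have "card (inversions (shift_perm s p)) = card (inversions p)"
    by (simp add: bij_betw_same_card)
  then show ?thesis
    using sign_eq_inversions[OF p] sign_eq_inversions[OF shift_perm_permutes[OF p]] by simp
qed

text \<open>The Grassmannian permutation of \<open>I\<close> and \<open>K\<close>: its values are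
  the elements of \<open>I\<close> in increasing order followed by those of \<open>K\<close> in
  increasing order.\<close>

definition shuffle :: "nat set \<Rightarrow> nat set \<Rightarrow> nat \<Rightarrow> nat" where
  "shuffle I K x = (if x < card I then pick I x
     else if x < card I + card K then pick K (x - card I) else x)"

lemma shuffle_permutes:
  assumes "I \<union> K = {0..<s}" "I \<inter> K = {}"
  shows "shuffle I K permutes {0..<s}"
proof (rule inj_imp_permutes)
  have fin: "finite I" "finite K" using assms by (metis finite_Un finite_atLeastLessThan)+
  then have s: "card I + card K = s" using assms by (metis card_Un_disjoint card_atLeastLessThan diff_zero)
  have lo: "shuffle I K x = pick I x \<and> shuffle I K x \<in> I" if "x < card I" for x
    using that pick_in_set_le by (simp add: shuffle_def)
  have hi: "shuffle I K x = pick K (x - card I) \<and> x - card I < card K \<and> shuffle I K x \<in> K"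
    if "card I \<le> x" "x < s" for x
    using that s pick_in_set_le[of "x - card I" K] by (simp add: shuffle_def)
  show "inj_on (shuffle I K) {0..<s}"
  proof (rule inj_onI)
    fix x y assume xy: "x \<in> {0..<s}" "y \<in> {0..<s}" and eq: "shuffle I K x = shuffle I K y"
    consider "x < card I" "y < card I" | "card I \<le> x" "card I \<le> y"
      | "x < card I" "card I \<le> y" | "card I \<le> x" "y < card I" by linarith
    then show "x = y"
    proof cases
      case 1
      then have "pick I x = pick I y" using eq lo by simp
      then show ?thesis using 1 bij_betw_imp_inj_on[OF bij_betw_pick[OF fin(1)]] by (simp add: inj_on_def)
    next
      case 2
      then have "pick K (x - card I) = pick K (y - card I)" "x - card I < card K" "y - card I < card K"
        using eq hi[of x] hi[of y] xy by auto
      then have "x - card I = y - card I"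
        using bij_betw_imp_inj_on[OF bij_betw_pick[OF fin(2)]] by (simp add: inj_on_def)
      then show ?thesis using 2 by simp
    next
      case 3
      then have "shuffle I K x \<in> I" "shuffle I K y \<in> K" using lo[of x] hi[of y] xy by auto
      then show ?thesis using eq assms(2) by auto
    next
      case 4
      then have "shuffle I K y \<in> I" "shuffle I K x \<in> K" using lo[of y] hi[of x] xy by auto
      then show ?thesis using eq assms(2) by auto
    qed
  qed
  show "shuffle I K x \<in> {0..<s}" if "x \<in> {0..<s}" for x
  proof (cases "x < card I")
    case True
    then have "shuffle I K x \<in> I" using lo by blast
    then show ?thesis using assms(1) by blast
  next
    case False
    then have "shuffle I K x \<in> K" using hi[of x] that by auto
    then show ?thesis using assms(1) by blast
  qed
  show "shuffle I K x = x" if "x \<notin> {0..<s}" for x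
    using that s by (auto simp: shuffle_def)
qed simp

text \<open>Both blocks are listed increasingly, so an inversion has its first position in the block
  of \<open>I\<close> and its second in that of \<open>K\<close>. Applying the permutation to both
  positions turns inversions into the pairs counted by \<open>inv_pairs\<close>.\<close>

lemma card_inversions_shuffle:
  assumes "I \<union> K = {0..<s}" "I \<inter> K = {}"
  shows "card (inversions (shuffle I K)) = inv_pairs I K"
proof -
  have fin: "finite I" "finite K" using assms by (metis finite_Un finite_atLeastLessThan)+
  then have s: "card I + card K = s" using assms by (metis card_Un_disjoint card_atLeastLessThan diff_zero)
  note perm = shuffle_permutes[OF assms]
  have lo: "shuffle I K k = pick I k" if "k < card I" for k
    using that by (simp add: shuffle_def)
  have hi: "shuffle I K (card I + k) = pick K k" if "k < card K" for k
    using that by (simp add: shuffle_def)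
  have split: "k < card I \<and> card I \<le> i" if inv: "(k, i) \<in> inversions (shuffle I K)" for k i
  proof (rule ccontr)
    assume neg: "\<not> ?thesis"
    have ki: "k < i" "i < s" "shuffle I K i < shuffle I K k"
      using inv inversions_bound[OF perm inv] by (auto simp: inversions_def)
    show False
    proof (cases "i < card I")
      case True
      then show False using ki pick_less_iff[of i I k] lo by simp
    next
      case False
      then have "pick K (i - card I) < pick K (k - card I)"
        using neg ki s hi[of "i - card I"] hi[of "k - card I"] by simp
      then show False using pick_less_iff[of "i - card I" K "k - card I"] False neg ki s by auto
    qed
  qed
  let ?g = "map_prod (shuffle I K) (shuffle I K)" and ?P = "{(a, b). a \<in> I \<and> b \<in> K \<and> a > b}"
  have "?g ` inversions (shuffle I K) = ?P"
  proof (intro equalityI subsetI)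
    fix x assume "x \<in> ?g ` inversions (shuffle I K)"
    then obtain k i where x: "x = (shuffle I K k, shuffle I K i)" and ki: "(k, i) \<in> inversions (shuffle I K)"
      by auto
    moreover have "i < s" using inversions_bound[OF perm ki] .
    moreover from this have "i - card I < card K" using split[OF ki] s by linarith
    ultimately have "shuffle I K k \<in> I" "shuffle I K i \<in> K"
      using split[OF ki] lo[of k] hi[of "i - card I"] pick_in_set_le[of k I] pick_in_set_le[of "i - card I" K]
      by simp_all
    then show "x \<in> ?P"
      using x ki by (simp add: inversions_def)
  next
    fix x assume "x \<in> ?P"
    then obtain a b where x: "x = (a, b)" "a \<in> I" "b \<in> K" "b < a" by auto
    obtain k where k: "k < card I" "pick I k = a"
      using x bij_betw_imp_surj_on[OF bij_betw_pick[OF fin(1)]] by (metis atLeastLessThan_iff imageE)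
    obtain i where i: "i < card K" "pick K i = b"
      using x bij_betw_imp_surj_on[OF bij_betw_pick[OF fin(2)]] by (metis atLeastLessThan_iff imageE)
    show "x \<in> ?g ` inversions (shuffle I K)"
      using x k i lo hi by (intro image_eqI[of _ _ "(k, card I + i)"]) (auto simp: inversions_def)
  qed
  moreover have "inj_on ?g (inversions (shuffle I K))"
    by (auto simp: inj_on_def inj_eq[OF permutes_inj[OF perm]])
  ultimately have "card (inversions (shuffle I K)) = card ?P"
    by (metis card_image)
  then show ?thesis by (simp add: inv_pairs_def)
qed

lemma inv_pairs_swap:
  assumes "finite I" "finite K" "I \<inter> K = {}"
  shows "inv_pairs I K + inv_pairs K I = card I * card K"
proof -
  let ?P = "{(a, b). a \<in> I \<and> b \<in> K \<and> a > b}" and ?Q = "{(a, b). a \<in> K \<and> b \<in> I \<and> a > b}"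
  have "finite (I \<times> K)" using assms by simp
  moreover have "?P \<subseteq> I \<times> K" "prod.swap ` ?Q \<subseteq> I \<times> K" by auto
  ultimately have fin: "finite ?P" "finite (prod.swap ` ?Q)" by (meson finite_subset)+
  have "I \<times> K = ?P \<union> prod.swap ` ?Q"
    using assms(3) by (fastforce simp: image_iff)
  moreover have "?P \<inter> prod.swap ` ?Q = {}" by auto
  ultimately have "card (I \<times> K) = card ?P + card (prod.swap ` ?Q)"
    using card_Un_disjoint[OF fin] by simp
  then show ?thesis
    by (simp add: inv_pairs_def card_image card_cartesian_product)
qed

text \<open>The inversions count pairs with the larger element in \<open>I\<close>, while the sum to
  be evaluated counts those with the larger element in \<open>K\<close>. The two counts add up to
  \<open>card I * card K\<close>, which is even, so they give the same sign.\<close>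

lemma sign_shuffle:
  assumes "I \<union> K = {0..<s}" "I \<inter> K = {}" "even (card K)"
  shows "sign (shuffle I K) = (- 1) ^ inv_pairs K I"
proof -
  have fin: "finite I" "finite K" using assms by (metis finite_Un finite_atLeastLessThan)+
  have "even (inv_pairs I K + inv_pairs K I)"
    using inv_pairs_swap[OF fin assms(2)] assms(3) by simp
  then show ?thesis
    using sign_eq_inversions[OF shuffle_permutes[OF assms(1,2)]] card_inversions_shuffle[OF assms(1,2)]
    by (auto simp: minus_one_power_iff)
qed

section \<open>Permutations that preserve an initial block\<close>

text \<open>The reference matching {0, n}, {1, n + 1}, ... in the encoding of perfect matchings,
  where positions 2i and 2i + 1 hold the two ends of a pair.\<close>

definition interleave :: "nat \<Rightarrow> nat \<Rightarrow> nat" where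
  "interleave n x = (if x < 2 * n then if even x then x div 2 else n + x div 2 else x)"

lemma interleave_simps [simp]:
  "i < n \<Longrightarrow> interleave n (2 * i) = i"
  "i < n \<Longrightarrow> interleave n (Suc (2 * i)) = n + i"
  "interleave n (2 * n + l) = 2 * n + l"
  by (simp_all add: interleave_def)

lemma interleave_cases:
  obtains (even) i where "i < n" "x = 2 * i" "interleave n x = i"
  | (odd) i where "i < n" "x = Suc (2 * i)" "interleave n x = n + i"
  | (rest) "2 * n \<le> x" "interleave n x = x"
proof (cases "x < 2 * n")
  case True
  then show ?thesis
    using even[of "x div 2"] odd[of "x div 2"] by (cases "even x") (auto simp: interleave_def)
next
  case False
  then show ?thesis using rest by (simp add: interleave_def)
qed

lemma interleave_permutes: "interleave n permutes {0..<2 * n + N}"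
proof (rule inj_imp_permutes)
  show "inj_on (interleave n) {0..<2 * n + N}"
  proof (rule inj_onI)
    fix x y assume "interleave n x = interleave n y"
    then show "x = y"
      by (cases n x rule: interleave_cases; cases n y rule: interleave_cases) simp_all
  qed
qed (auto simp: interleave_def)

text \<open>The inversions are exactly the pairs of positions (2i + 1, 2j) with i < j < n, whose
  values are n + i and j.\<close>

lemma sign_interleave: "sign (interleave n) = (- 1) ^ card {(i, j). i < j \<and> j < n}"
proof -
  have "(k, i) \<in> (\<lambda>(i, j). (Suc (2 * i), 2 * j)) ` {(i, j). i < j \<and> j < n}"
    if "(k, i) \<in> inversions (interleave n)" for k i
  proof -
    have ki: "k < i" "interleave n i < interleave n k"
      using that by (simp_all add: inversions_def)
    show ?thesis
      using ki
      by (cases n k rule: interleave_cases; cases n i rule: interleave_cases) (simp_all add: image_iff)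
  qed
  moreover have "(Suc (2 * i), 2 * j) \<in> inversions (interleave n)" if "i < j" "j < n" for i j
    using that by (auto simp: inversions_def interleave_def)
  ultimately have "bij_betw (\<lambda>(i, j). (Suc (2 * i), 2 * j)) {(i, j). i < j \<and> j < n} (inversions (interleave n))"
    unfolding bij_betw_def inj_on_def by auto
  then have "card (inversions (interleave n)) = card {(i, j). i < j \<and> j < n}"
    by (simp add: bij_betw_same_card)
  then show ?thesis
    using sign_eq_inversions[OF interleave_permutes[of n 0]] by simp
qed

text \<open>By injectivity the complement of the preserved block is preserved too, so the two
  restrictions can be read off. This yields the preimages in both \<open>bij_betw_match_perm\<close>
  and \<open>bij_betw_shuffle\<close>.\<close>

lemma permutes_split:
  assumes v: "v permutes {0..<n + N}" and im: "v ` {0..<n} = {0..<n}"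
  obtains \<sigma> q where "\<sigma> permutes {0..<n}" "q permutes {0..<N}" "v = \<sigma> \<circ> shift_perm n q"
proof
  let ?\<sigma> = "\<lambda>i. if i < n then v i else i" and ?q = "\<lambda>j. if j < N then v (n + j) - n else j"
  have lo: "v i < n" if "i < n" for i using im that by auto
  have hi: "n \<le> v i" if "n \<le> i" for i
  proof (rule ccontr)
    assume "\<not> n \<le> v i"
    then have "v i \<in> v ` {0..<n}" using im by simp
    then show False using inj_image_mem_iff[OF permutes_inj[OF v], of i] that by simp
  qed
  have top: "v i < n + N" if "i < n + N" for i using permutes_in_image[OF v, of i] that by simp
  show "?\<sigma> permutes {0..<n}"
    using lo by (intro inj_imp_permutes) (auto simp: inj_on_def inj_eq[OF permutes_inj[OF v]])
  show "?q permutes {0..<N}"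
  proof (rule inj_imp_permutes)
    show "inj_on ?q {0..<N}"
    proof (rule inj_onI)
      fix x y assume "x \<in> {0..<N}" "y \<in> {0..<N}" "?q x = ?q y"
      then have "v (n + x) = v (n + y)"
        using hi[of "n + x"] hi[of "n + y"] by simp
      then show "x = y" using inj_eq[OF permutes_inj[OF v]] by simp
    qed
    show "?q x \<in> {0..<N}" if "x \<in> {0..<N}" for x
      using that top[of "n + x"] hi[of "n + x"] by auto
  qed auto
  show "v = ?\<sigma> \<circ> shift_perm n ?q"
  proof
    fix i
    show "v i = (?\<sigma> \<circ> shift_perm n ?q) i"
      using lo[of i] hi[of i] permutes_not_in[OF v, of i] by (auto simp: shift_perm_def)
  qed
qed

subsection \<open>Pfaffians with a zero block\<close>

text \<open>Encodes a matching whose first n pairs are {i, n + w i}; the values of \<open>w\<close>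
  from position n on list the ends of the remaining pairs.\<close>

definition match_perm :: "nat \<Rightarrow> (nat \<Rightarrow> nat) \<Rightarrow> nat \<Rightarrow> nat" where
  "match_perm n w = shift_perm n w \<circ> interleave n"

lemma match_perm_simps [simp]:
  "i < n \<Longrightarrow> match_perm n w (2 * i) = i"
  "i < n \<Longrightarrow> match_perm n w (Suc (2 * i)) = n + w i"
  by (simp_all add: match_perm_def)

lemma match_perm_tail [simp]: "match_perm n w (2 * n + l) = n + w (n + l)"
  using shift_perm_add[of n w "n + l"] unfolding match_perm_def comp_def interleave_simps
  by (simp add: mult_2 add.assoc)

text \<open>If p (2i) = i for i < n, then undoing the interleaving leaves a permutation that fixes
  0, ..., n - 1 pointwise, and such a permutation is a shifted one.\<close>

lemma bij_betw_match_perm: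
  "bij_betw (match_perm n) {w. w permutes {0..<n + N}}
     {p. p permutes {0..<2 * n + N} \<and> (\<forall>i<n. p (2 * i) = i)}"
proof -
  have "inj_on (match_perm n) {w. w permutes {0..<n + N}}"
  proof (rule inj_onI)
    fix w w' assume eq: "match_perm n w = match_perm n w'"
    show "w = w'"
    proof
      fix x
      show "w x = w' x"
      proof (cases "x < n")
        case True
        then show ?thesis using fun_cong[OF eq, of "Suc (2 * x)"] by simp
      next
        case False
        then show ?thesis using fun_cong[OF eq, of "2 * n + (x - n)"] unfolding match_perm_tail by simp
      qed
    qed
  qed
  moreover have "match_perm n w permutes {0..<2 * n + N}" if "w permutes {0..<n + N}" for w
    using permutes_compose[OF interleave_permutes[of n N], of "shift_perm n w"]
      shift_perm_permutes[OF that, of n]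
    by (simp add: match_perm_def mult_2 add.assoc)
  moreover have "p \<in> match_perm n ` {w. w permutes {0..<n + N}}"
    if p: "p permutes {0..<2 * n + N}" and ev: "\<forall>i<n. p (2 * i) = i" for p
  proof -
    let ?v = "p \<circ> inv_into UNIV (interleave n)"
    have v: "?v permutes {0..<n + (n + N)}"
      using permutes_compose[OF permutes_inv[OF interleave_permutes[of n N]] p]
      by (simp add: mult_2 add.assoc)
    have vi: "?v i = i" if "i < n" for i
      using permutes_inverses(2)[OF interleave_permutes, of n "2 * i"] that ev by simp
    then have "?v ` {0..<n} = {0..<n}" by (auto simp: image_iff)
    then obtain \<sigma> q where q: "\<sigma> permutes {0..<n}" "q permutes {0..<n + N}" "?v = \<sigma> \<circ> shift_perm n q"
      using permutes_split[OF v] by metis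
    have "\<sigma> i = i" for i
    proof (cases "i < n")
      case True
      then show ?thesis using fun_cong[OF q(3), of i] vi[of i] by simp
    next
      case False
      then show ?thesis using permutes_not_in[OF q(1), of i] by simp
    qed
    then have "?v = shift_perm n q" using q(3) by auto
    moreover have "p = ?v \<circ> interleave n"
      using permutes_inv_o(2)[OF interleave_permutes[of n N]] by (simp add: comp_assoc)
    ultimately show ?thesis using q(2) by (auto simp: match_perm_def)
  qed
  ultimately show ?thesis
    unfolding bij_betw_def by (auto 0 3)
qed

lemma sign_match_perm:
  assumes "w permutes {0..<n + N}"
  shows "sign (match_perm n w) = (- 1) ^ card {(i, j). i < j \<and> j < n} * sign w"
proof -
  have "permutation (shift_perm n w)" "permutation (interleave n)"
    using shift_perm_permutes[OF assms] interleave_permutes[of n 0]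
    by (auto simp: permutation_permutes)
  then show ?thesis
    using sign_shift_perm[OF assms] by (simp add: match_perm_def sign_compose sign_interleave)
qed

text \<open>What \<open>perfect_matchings\<close> demands of the pairs after the first n, expressed
  through \<open>w\<close>.\<close>

definition matching_tail :: "nat \<Rightarrow> nat \<Rightarrow> (nat \<Rightarrow> nat) \<Rightarrow> bool" where
  "matching_tail n h w \<longleftrightarrow> (\<forall>i<h. w (n + 2 * i) < w (n + (2 * i + 1))) \<and>
     (\<forall>i j. i < j \<and> j < h \<longrightarrow> w (n + 2 * i) < w (n + 2 * j))"

lemma less_add_cases:
  fixes i :: nat
  assumes "i < n + h"
  obtains "i < n" | j where "j < h" "i = n + j"
  using assms by (metis add_less_cancel_left le_add_diff_inverse not_less)

text \<open>The first n pairs start at 0, ..., n - 1 and end at n or later, while all other pairs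
  start at n or later. Every order condition involving one of the first n pairs is therefore
  automatic.\<close>

lemma match_perm_in_perfect_matchings:
  assumes w: "w permutes {0..<n + 2 * h}"
  shows "match_perm n w \<in> perfect_matchings (n + h) \<longleftrightarrow> matching_tail n h w"
proof -
  have perm: "match_perm n w permutes {0..<2 * (n + h)}"
    using bij_betw_match_perm[of n "2 * h"] w by (auto simp: bij_betw_def algebra_simps)
  have ev: "match_perm n w (2 * (n + j)) = n + w (n + 2 * j)"
    and od: "match_perm n w (Suc (2 * (n + j))) = n + w (n + (2 * j + 1))" for j
    using match_perm_tail[of n w "2 * j"] match_perm_tail[of n w "2 * j + 1"]
    by (simp_all add: algebra_simps)
  have "(\<forall>i<n + h. match_perm n w (2 * i) < match_perm n w (2 * i + 1))
      \<longleftrightarrow> (\<forall>i<h. w (n + 2 * i) < w (n + (2 * i + 1)))" (is "?L1 \<longleftrightarrow> ?R1")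
  proof
    assume ?L1
    then show ?R1 using ev od by (metis Suc_eq_plus1 add_less_cancel_left)
  next
    assume R: ?R1
    show ?L1
    proof (intro allI impI)
      fix i assume "i < n + h"
      then show "match_perm n w (2 * i) < match_perm n w (2 * i + 1)"
        by (cases rule: less_add_cases) (use R ev od in simp_all)
    qed
  qed
  moreover have "(\<forall>i j. i < j \<and> j < n + h \<longrightarrow> match_perm n w (2 * i) < match_perm n w (2 * j))
      \<longleftrightarrow> (\<forall>i j. i < j \<and> j < h \<longrightarrow> w (n + 2 * i) < w (n + 2 * j))" (is "?L2 \<longleftrightarrow> ?R2")
  proof
    assume ?L2
    then show ?R2 using ev by (metis add_less_cancel_left)
  next
    assume R: ?R2
    show ?L2
    proof (intro allI impI)
      fix i j assume ij: "i < j \<and> j < n + h"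
      then have i: "i < n + h" and j: "j < n + h" by auto
      from i show "match_perm n w (2 * i) < match_perm n w (2 * j)"
      proof (cases rule: less_add_cases)
        case 1
        from j show ?thesis
          by (cases rule: less_add_cases) (use 1 ij ev in simp_all)
      next
        case (2 i')
        from j show ?thesis
          by (cases rule: less_add_cases) (use 2 ij ev R in simp_all)
      qed
    qed
  qed
  ultimately show ?thesis
    using perm by (simp add: perfect_matchings_def matching_tail_def)
qed

text \<open>Let the value i be taken at k. By induction k < i is impossible. If i < k, then f i < i,
  and induction at f i shows that f takes the same value at f i and at i, contradicting
  monotonicity.\<close>

lemma strict_mono_fixes_initial:
  fixes f :: "nat \<Rightarrow> nat"
  assumes mono: "\<And>i j. i < j \<Longrightarrow> j < K \<Longrightarrow> f i < f j"
    and im: "{..<n} \<subseteq> f ` {..<K}" and "i < n"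
  shows "f i = i"
  using \<open>i < n\<close>
proof (induction i rule: less_induct)
  case (less i)
  obtain k where k: "k < K" "f k = i" using im less.prems by auto
  have "\<not> k < i" using less.IH[of k] less.prems k by auto
  moreover have "\<not> i < k"
  proof
    assume "i < k"
    then have "f i < i" using mono k by auto
    then have "f (f i) = f i" using less by auto
    then show False using mono[of "f i" i] \<open>f i < i\<close> \<open>i < k\<close> k(1) by auto
  qed
  ultimately show ?case using k by auto
qed

text \<open>When no pair has its larger end below n, each point below n is the smaller end of its
  pair. The smaller ends increase, so these points come first and in order.\<close>

lemma perfect_matching_partners:
  assumes p: "p \<in> perfect_matchings K" and n: "n \<le> 2 * K"
    and partners: "\<forall>i<K. n \<le> p (2 * i + 1)" and i: "i < n"
  shows "p (2 * i) = i"
proof (rule strict_mono_fixes_initial[of K "\<lambda>i. p (2 * i)", OF _ _ i])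
  show "p (2 * i) < p (2 * j)" if "i < j" "j < K" for i j
    using p that by (auto simp: perfect_matchings_def)
  have perm: "p permutes {0..<2 * K}" using p by (simp add: perfect_matchings_def)
  show "{..<n} \<subseteq> (\<lambda>i. p (2 * i)) ` {..<K}"
  proof
    fix a assume a: "a \<in> {..<n}"
    then have "a \<in> p ` {0..<2 * K}" using n unfolding permutes_image[OF perm] by simp
    then obtain x where x: "x < 2 * K" "p x = a" by auto
    have "even x"
    proof (rule ccontr)
      assume "odd x"
      then obtain j where j: "x = 2 * j + 1" by (auto elim: oddE)
      then have "n \<le> a" using x partners by auto
      then show False using a by simp
    qed
    then obtain j where "x = 2 * j" by (auto elim: evenE)
    then show "a \<in> (\<lambda>i. p (2 * i)) ` {..<K}" using x by (intro image_eqI[of _ _ j]) simp_all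
  qed
qed

lemma prod_lessThan_add: "prod f {..<n + (h::nat)} = prod f {..<n} * (\<Prod>j<h. f (n + j) :: 'a::comm_monoid_mult)"
  by (induction h) (simp_all add: mult.assoc)

lemma shuffle_simps:
  "x < card I \<Longrightarrow> shuffle I K x = pick I x"
  "x < card K \<Longrightarrow> shuffle I K (card I + x) = pick K x"
  by (simp_all add: shuffle_def)

text \<open>A permutation that sends the first n positions onto \<open>I\<close> amounts to an order
  \<open>\<sigma>\<close> in which \<open>I\<close> is listed and an order \<open>q\<close> in which
  \<open>K\<close> is listed. Composing with the inverse shuffle gives a permutation preserving the
  initial block, which then splits.\<close>

lemma bij_betw_shuffle:
  assumes IK: "I \<union> K = {0..<n + N}" "I \<inter> K = {}" and card: "card I = n" "card K = N"
  shows "bij_betw (\<lambda>(\<sigma>, q). shuffle I K \<circ> \<sigma> \<circ> shift_perm n q)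
    ({\<sigma>. \<sigma> permutes {0..<n}} \<times> {q. q permutes {0..<N}})
    {w. w permutes {0..<n + N} \<and> w ` {0..<n} = I}"
proof -
  let ?f = "\<lambda>(\<sigma>, q). shuffle I K \<circ> \<sigma> \<circ> shift_perm n q"
  let ?S = "shuffle I K"
  note perm = shuffle_permutes[OF IK]
  have fin: "finite I" using IK by (metis finite_Un finite_atLeastLessThan)
  have im: "?S ` {0..<n} = I"
  proof -
    have "?S ` {0..<n} = pick I ` {0..<n}"
      using shuffle_simps(1)[of _ I K] card by (intro image_cong) auto
    then show ?thesis using bij_betw_imp_surj_on[OF bij_betw_pick[OF fin]] card by simp
  qed
  have "inj_on ?f ({\<sigma>. \<sigma> permutes {0..<n}} \<times> {q. q permutes {0..<N}})"
  proof (rule inj_onI, clarsimp)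
    fix \<sigma> q \<sigma>' q'
    assume \<sigma>: "\<sigma> permutes {0..<n}" "\<sigma>' permutes {0..<n}"
      and eq: "?S \<circ> \<sigma> \<circ> shift_perm n q = ?S \<circ> \<sigma>' \<circ> shift_perm n q'"
    have eq': "\<sigma> (shift_perm n q x) = \<sigma>' (shift_perm n q' x)" for x
      using fun_cong[OF eq, of x] inj_eq[OF permutes_inj[OF perm]] by simp
    have "\<sigma> = \<sigma>'"
    proof
      fix x show "\<sigma> x = \<sigma>' x"
        using eq'[of x] \<sigma> by (cases "x < n") (simp_all add: permutes_not_in)
    qed
    moreover have "q = q'"
    proof
      fix x show "q x = q' x"
        using eq'[of "n + x"] \<sigma> by (simp add: permutes_not_in)
    qed
    ultimately show "\<sigma> = \<sigma>' \<and> q = q'" by simp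
  qed
  moreover have "?f (\<sigma>, q) \<in> {w. w permutes {0..<n + N} \<and> w ` {0..<n} = I}"
    if \<sigma>: "\<sigma> permutes {0..<n}" and q: "q permutes {0..<N}" for \<sigma> q
  proof -
    have "\<sigma> permutes {0..<n + N}" using permutes_subset[OF \<sigma>] by auto
    then have "?S \<circ> \<sigma> \<circ> shift_perm n q permutes {0..<n + N}"
      by (intro permutes_compose perm shift_perm_permutes[OF q])
    moreover have "shift_perm n q ` {0..<n} = {0..<n}" by (simp add: image_def)
    then have "(?S \<circ> \<sigma> \<circ> shift_perm n q) ` {0..<n} = I"
      unfolding image_comp[symmetric] using permutes_image[OF \<sigma>] im by simp
    ultimately show ?thesis by simp
  qed
  moreover have "w \<in> ?f ` ({\<sigma>. \<sigma> permutes {0..<n}} \<times> {q. q permutes {0..<N}})"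
    if w: "w permutes {0..<n + N}" and wI: "w ` {0..<n} = I" for w
  proof -
    let ?v = "inv_into UNIV ?S \<circ> w"
    have v: "?v permutes {0..<n + N}" by (intro permutes_compose[OF w] permutes_inv perm)
    have "?v ` {0..<n} = inv_into UNIV ?S ` (?S ` {0..<n})"
      unfolding image_comp[symmetric] wI im ..
    also have "\<dots> = {0..<n}"
      unfolding image_comp permutes_inv_o(2)[OF perm] by simp
    finally obtain \<sigma> q where *: "\<sigma> permutes {0..<n}" "q permutes {0..<N}" "?v = \<sigma> \<circ> shift_perm n q"
      using permutes_split[OF v] by metis
    have "w = ?S \<circ> ?v"
      using permutes_inv_o(1)[OF perm] by (simp add: comp_assoc[symmetric])
    then have "w = ?f (\<sigma>, q)" using *(3) by (simp add: comp_assoc)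
    then show ?thesis using *(1,2) by blast
  qed
  ultimately show ?thesis
    unfolding bij_betw_def by (intro conjI equalityI image_subsetI) blast+
qed

text \<open>From position n on, the composition is \<open>pick K\<close> after \<open>q\<close>, and
  \<open>pick K\<close> is increasing on the relevant indices, so all comparisons can be made for
  \<open>q\<close> alone.\<close>

lemma matching_tail_shuffle:
  assumes \<sigma>: "\<sigma> permutes {0..<n}" and q: "q permutes {0..<2 * h}"
    and card: "card I = n" "card K = 2 * h"
  shows "matching_tail n h (shuffle I K \<circ> \<sigma> \<circ> shift_perm n q) \<longleftrightarrow> q \<in> perfect_matchings h"
proof -
  define w where "w = shuffle I K \<circ> \<sigma> \<circ> shift_perm n q"
  have val: "w (n + j) = pick K (q j)" and lt: "q j < 2 * h" if "j < 2 * h" for j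
    using that permutes_in_image[OF q, of j] permutes_not_in[OF \<sigma>, of "n + q j"]
      shuffle_simps(2)[of "q j" K I] card by (simp_all add: w_def)
  have "w (n + i) < w (n + j) \<longleftrightarrow> q i < q j" if "i < 2 * h" "j < 2 * h" for i j
    using that val lt pick_less_iff[of "q i" K "q j"] card by simp
  then show ?thesis
    using q unfolding w_def[symmetric] matching_tail_def perfect_matchings_def
    by (simp del: add_Suc_right)
qed

lemma finite_perfect_matchings: "finite (perfect_matchings k)"
  unfolding perfect_matchings_def by (rule finite_subset[OF _ finite_permutations[of "{0..<2 * k}"]]) auto

text \<open>A perfect matching contributes only if the first \<open>n\<close> points are all matched with later ones;
  it is then encoded by the partners \<open>I\<close> of these points, the order in which they occur, and a
  matching of the complement of \<open>I\<close>.\<close>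

lemma Pf_four_block_zero:
  fixes M :: "'a::comm_ring_1 mat"
  assumes M: "M \<in> carrier_mat n (n + N)" and A: "A \<in> carrier_mat (n + N) (n + N)"
    and C: "C \<in> carrier_mat (n + N) n" and "even N"
  shows "Pf (four_block_mat (0\<^sub>m n n) M C A) = (- 1) ^ card {(i, j). i < j \<and> j < n} *
    (\<Sum>I | I \<subseteq> {..<n + N} \<and> card I = n. (- 1) ^ inv_pairs ({..<n + N} - I) I *
       Pf (submatrix A ({..<n + N} - I) ({..<n + N} - I)) * det (submatrix M UNIV I))"
proof -
  obtain h where N: "N = 2 * h" using \<open>even N\<close> by (auto elim: evenE)
  let ?X = "four_block_mat (0\<^sub>m n n) M C A"
  let ?d = "(- 1) ^ card {(i, j). i < j \<and> j < n} :: 'a"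
  define f where "f p = of_int (sign p) * (\<Prod>i<n + h. ?X $$ (p (2 * i), p (2 * i + 1)))" for p
  define g where "g w = of_int (sign w) * ((\<Prod>i<n. M $$ (i, w i)) *
      (\<Prod>j<h. A $$ (w (n + 2 * j), w (n + (2 * j + 1)))))" for w
  define W where "W = {w. w permutes {0..<n + 2 * h} \<and> matching_tail n h w}"
  define P where "P = {p \<in> perfect_matchings (n + h). \<forall>i<n. p (2 * i) = i}"
  have "finite W"
    unfolding W_def by (rule finite_subset[OF _ finite_permutations[of "{0..<n + 2 * h}"]]) auto
  have "Pf ?X = (\<Sum>p\<in>perfect_matchings (n + h). f p)"
    using A M unfolding Pf_def f_def N by (simp add: algebra_simps)
  also have "\<dots> = (\<Sum>p\<in>P. f p)"
  proof (rule sum.mono_neutral_right[OF finite_perfect_matchings])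
    show "\<forall>p\<in>perfect_matchings (n + h) - P. f p = 0"
    proof
      fix p assume "p \<in> perfect_matchings (n + h) - P"
      then have p: "p \<in> perfect_matchings (n + h)" and "\<not> (\<forall>i<n. p (2 * i) = i)"
        by (auto simp: P_def)
      \<comment> \<open>By \<open>perfect_matching_partners\<close>, some pair has its larger end,
        hence both ends, below n; its entry lies in the zero block.\<close>
      then have "\<not> (\<forall>i<n + h. n \<le> p (2 * i + 1))"
        using perfect_matching_partners[OF p, of n] by auto
      then obtain i where i: "i < n + h" "p (2 * i + 1) < n"
        unfolding not_all not_imp not_le by blast
      moreover have "p (2 * i) < p (2 * i + 1)" using p i by (auto simp: perfect_matchings_def)
      ultimately have "?X $$ (p (2 * i), p (2 * i + 1)) = 0"
        using A M by (simp add: index_mat_four_block)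
      then have "(\<Prod>i<n + h. ?X $$ (p (2 * i), p (2 * i + 1))) = 0"
        using i by (intro prod_zero) auto
      then show "f p = 0" by (simp add: f_def)
    qed
  qed (auto simp: P_def)
  also have "\<dots> = (\<Sum>w\<in>W. f (match_perm n w))"
  proof (rule sum.reindex_bij_betw[symmetric])
    have "P = {p. p permutes {0..<2 * n + 2 * h} \<and> (\<forall>i<n. p (2 * i) = i)} \<inter> perfect_matchings (n + h)"
      by (auto simp: P_def perfect_matchings_def algebra_simps)
    moreover note b = bij_betw_match_perm[of n "2 * h"]
    ultimately have "P = match_perm n ` W"
      using match_perm_in_perfect_matchings[of _ n h] bij_betw_imp_surj_on[OF b, symmetric]
      unfolding W_def by auto
    moreover have "W \<subseteq> {w. w permutes {0..<n + 2 * h}}" by (auto simp: W_def)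
    ultimately show "bij_betw (match_perm n) W P"
      using bij_betw_imp_inj_on[OF b] by (auto simp: bij_betw_def intro: inj_on_subset)
  qed
  also have "\<dots> = (\<Sum>w\<in>W. ?d * g w)"
  proof (rule sum.cong)
    fix w assume "w \<in> W"
    then have w: "w permutes {0..<n + 2 * h}" by (simp add: W_def)
    have lt: "w x < n + 2 * h" if "x < n + 2 * h" for x using permutes_in_image[OF w, of x] that by simp
    \<comment> \<open>The first n pairs {i, n + w i} read the upper right block, the remaining pairs
      the lower right block.\<close>
    have low: "?X $$ (match_perm n w (2 * i), match_perm n w (2 * i + 1)) = M $$ (i, w i)" if "i < n" for i
      using that lt[of i] A M N by simp
    have high: "?X $$ (match_perm n w (2 * (n + j)), match_perm n w (2 * (n + j) + 1))
        = A $$ (w (n + 2 * j), w (n + (2 * j + 1)))" if "j < h" for j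
    proof -
      have "match_perm n w (2 * (n + j)) = n + w (n + 2 * j)"
        "match_perm n w (2 * (n + j) + 1) = n + w (n + (2 * j + 1))"
        using match_perm_tail[of n w "2 * j"] match_perm_tail[of n w "2 * j + 1"]
        by (simp_all add: algebra_simps)
      then show ?thesis using that lt[of "n + 2 * j"] lt[of "n + (2 * j + 1)"] A M N by simp
    qed
    have "(\<Prod>i<n + h. ?X $$ (match_perm n w (2 * i), match_perm n w (2 * i + 1)))
        = (\<Prod>i<n. M $$ (i, w i)) * (\<Prod>j<h. A $$ (w (n + 2 * j), w (n + (2 * j + 1))))"
      unfolding prod_lessThan_add using low high by simp
    then show "f (match_perm n w) = ?d * g w"
      unfolding f_def g_def sign_match_perm[OF w] by simp
  qed simp
  also have "\<dots> = ?d * (\<Sum>w\<in>W. g w)" by (simp add: sum_distrib_left)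
  \<comment> \<open>The values of \<open>w\<close> on the first n positions are the columns chosen
    in \<open>M\<close>; grouping by the set of these columns produces the sum over
    \<open>I\<close>.\<close>
  also have "(\<Sum>w\<in>W. g w)
      = (\<Sum>I | I \<subseteq> {..<n + N} \<and> card I = n. \<Sum>w | w \<in> W \<and> w ` {0..<n} = I. g w)"
  proof (rule sum.group[symmetric, OF \<open>finite W\<close>])
    show "finite {I. I \<subseteq> {..<n + N} \<and> card I = n}" by simp
    show "(\<lambda>w. w ` {0..<n}) ` W \<subseteq> {I. I \<subseteq> {..<n + N} \<and> card I = n}"
    proof
      fix I assume "I \<in> (\<lambda>w. w ` {0..<n}) ` W"
      then obtain w where w: "w permutes {0..<n + N}" and I: "I = w ` {0..<n}" by (auto simp: W_def N)
      have "card I = n" unfolding I using permutes_inj_on[OF w] by (simp add: card_image)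
      moreover have "I \<subseteq> {..<n + N}"
      proof -
        have "I \<subseteq> w ` {0..<n + N}" unfolding I by (rule image_mono) simp
        then show ?thesis unfolding permutes_image[OF w] by (simp add: lessThan_atLeast0)
      qed
      ultimately show "I \<in> {I. I \<subseteq> {..<n + N} \<and> card I = n}" by simp
    qed
  qed
  also have "\<dots> = (\<Sum>I | I \<subseteq> {..<n + N} \<and> card I = n. (- 1) ^ inv_pairs ({..<n + N} - I) I *
       Pf (submatrix A ({..<n + N} - I) ({..<n + N} - I)) * det (submatrix M UNIV I))"
  proof (rule sum.cong)
    fix I assume "I \<in> {I. I \<subseteq> {..<n + N} \<and> card I = n}"
    then have I: "I \<subseteq> {..<n + N}" and cI: "card I = n" by auto
    define K where "K = {..<n + N} - I"
    have IK: "I \<union> K = {0..<n + N}" "I \<inter> K = {}" using I by (auto simp: K_def)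
    have cK: "card K = N"
      unfolding K_def using card_Diff_subset[OF finite_subset[OF I] I] cI by simp
    let ?S = "\<lambda>\<sigma> q. shuffle I K \<circ> \<sigma> \<circ> shift_perm n q"
    let ?s = "(- 1) ^ inv_pairs K I :: 'a"
    let ?Perm = "{\<sigma>. \<sigma> permutes {0..<n}}"
    \<comment> \<open>For fixed \<open>I\<close> the matching condition restricts only
      \<open>q\<close>: the unrestricted \<open>\<sigma>\<close> will give the determinant and
      \<open>q\<close> the Pfaffian.\<close>
    have bij: "bij_betw (\<lambda>(\<sigma>, q). ?S \<sigma> q) (?Perm \<times> perfect_matchings h) {w \<in> W. w ` {0..<n} = I}"
    proof -
      note b = bij_betw_shuffle[OF IK cI cK]
      have sub: "?Perm \<times> perfect_matchings h \<subseteq> ?Perm \<times> {q. q permutes {0..<N}}"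
        by (auto simp: perfect_matchings_def N)
      have tail: "matching_tail n h (?S \<sigma> q) \<longleftrightarrow> q \<in> perfect_matchings h"
        if "\<sigma> permutes {0..<n}" "q permutes {0..<N}" for \<sigma> q
        using matching_tail_shuffle[of \<sigma> n q h I K] that cI cK N by simp
      have "{w \<in> W. w ` {0..<n} = I}
          = {w \<in> (\<lambda>(\<sigma>, q). ?S \<sigma> q) ` (?Perm \<times> {q. q permutes {0..<N}}). matching_tail n h w}"
        unfolding bij_betw_imp_surj_on[OF b] by (auto simp: W_def N)
      also have "\<dots> = (\<lambda>(\<sigma>, q). ?S \<sigma> q) ` (?Perm \<times> perfect_matchings h)"
        using tail sub by auto
      finally show ?thesis
        using inj_on_subset[OF bij_betw_imp_inj_on[OF b] sub] by (simp add: bij_betw_def)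
    qed
    have "(\<Sum>w | w \<in> W \<and> w ` {0..<n} = I. g w) = (\<Sum>(\<sigma>, q)\<in>?Perm \<times> perfect_matchings h. g (?S \<sigma> q))"
      using sum.reindex_bij_betw[OF bij, of g] by (simp add: case_prod_beta)
    also have "\<dots> = (\<Sum>(\<sigma>, q)\<in>?Perm \<times> perfect_matchings h.
        ?s * ((of_int (sign q) * (\<Prod>j<h. A $$ (pick K (q (2 * j)), pick K (q (2 * j + 1))))) *
        (of_int (sign \<sigma>) * (\<Prod>i<n. M $$ (i, pick I (\<sigma> i))))))"
    proof (rule sum.cong, simp, clarify)
      fix \<sigma> q assume \<sigma>: "\<sigma> permutes {0..<n}" and "q \<in> perfect_matchings h"
      then have q: "q permutes {0..<N}" by (simp add: perfect_matchings_def N)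
      have perms: "permutation (shuffle I K)" "permutation \<sigma>" "permutation (shift_perm n q)"
        using shuffle_permutes[OF IK] \<sigma> shift_perm_permutes[OF q] by (auto simp: permutation_permutes)
      define w where "w = ?S \<sigma> q"
      have "sign w = (- 1) ^ inv_pairs K I * sign \<sigma> * sign q"
        using perms sign_shuffle[OF IK] cK \<open>even N\<close> sign_shift_perm[OF q]
        by (simp add: w_def sign_compose permutation_compose)
      moreover have "w i = pick I (\<sigma> i)" if "i < n" for i
        using that permutes_in_image[OF \<sigma>, of i] shuffle_simps(1)[of "\<sigma> i" I K] cI by (simp add: w_def)
      moreover have "w (n + j) = pick K (q j)" if "j < 2 * h" for j
        using that permutes_in_image[OF q, of j] permutes_not_in[OF \<sigma>, of "n + q j"]
          shuffle_simps(2)[of "q j" K I] cI cK N by (simp add: w_def)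
      ultimately show "g (?S \<sigma> q) =
        ?s * ((of_int (sign q) * (\<Prod>j<h. A $$ (pick K (q (2 * j)), pick K (q (2 * j + 1))))) *
        (of_int (sign \<sigma>) * (\<Prod>i<n. M $$ (i, pick I (\<sigma> i)))))"
        unfolding w_def[symmetric] g_def by (simp add: mult_ac del: add_Suc_right)
    qed
    also have "\<dots> = ?s * ((\<Sum>q\<in>perfect_matchings h.
          of_int (sign q) * (\<Prod>j<h. A $$ (pick K (q (2 * j)), pick K (q (2 * j + 1))))) *
        (\<Sum>\<sigma>\<in>?Perm. of_int (sign \<sigma>) * (\<Prod>i<n. M $$ (i, pick I (\<sigma> i)))))"
      unfolding sum_product sum.cartesian_product[symmetric]
      by (subst sum.swap) (simp add: sum_distrib_left)
    also have "(\<Sum>\<sigma>\<in>?Perm. of_int (sign \<sigma>) * (\<Prod>i<n. M $$ (i, pick I (\<sigma> i)))) = det (submatrix M UNIV I)"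
    proof -
      have "{j. j < n + N \<and> j \<in> I} = I" using I by auto
      then have dims: "card {i. i < dim_row M \<and> i \<in> UNIV} = n" "card {j. j < dim_col M \<and> j \<in> I} = n"
        using M cI by auto
      have "submatrix M UNIV I \<in> carrier_mat n n"
        using dims by (intro carrier_matI) (simp_all only: dim_submatrix)
      then have "det (submatrix M UNIV I) = (\<Sum>\<sigma>\<in>?Perm. of_int (sign \<sigma>) * (\<Prod>i<n. submatrix M UNIV I $$ (i, \<sigma> i)))"
        by (simp add: det_def' lessThan_atLeast0)
      also have "\<dots> = (\<Sum>\<sigma>\<in>?Perm. of_int (sign \<sigma>) * (\<Prod>i<n. M $$ (i, pick I (\<sigma> i))))"
      proof (rule sum.cong[OF refl], intro arg_cong2[where f = "(*)"] refl prod.cong)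
        fix \<sigma> i assume "\<sigma> \<in> ?Perm" "i \<in> {..<n}"
        then have "i < n" "\<sigma> i < n" using permutes_in_image[of \<sigma> "{0..<n}" i] by auto
        then show "submatrix M UNIV I $$ (i, \<sigma> i) = M $$ (i, pick I (\<sigma> i))"
          using submatrix_index[of i M UNIV "\<sigma> i" I] dims by (simp add: pick_UNIV)
      qed
      finally show ?thesis by simp
    qed
    also have "(\<Sum>q\<in>perfect_matchings h.
          of_int (sign q) * (\<Prod>j<h. A $$ (pick K (q (2 * j)), pick K (q (2 * j + 1))))) = Pf (submatrix A K K)"
    proof -
      have "{j. j < n + N \<and> j \<in> K} = K" by (auto simp: K_def)
      then have dims: "card {i. i < dim_row A \<and> i \<in> K} = 2 * h" "card {j. j < dim_col A \<and> j \<in> K} = 2 * h"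
        using A cK N by auto
      then have dim: "dim_row (submatrix A K K) = 2 * h" by (simp add: dim_submatrix)
      have "submatrix A K K $$ (q (2 * j), q (2 * j + 1)) = A $$ (pick K (q (2 * j)), pick K (q (2 * j + 1)))"
        if "q \<in> perfect_matchings h" "j < h" for q j
      proof -
        have q: "q permutes {0..<2 * h}" using that by (simp add: perfect_matchings_def)
        show ?thesis
          using permutes_in_image[OF q, of "2 * j"] permutes_in_image[OF q, of "2 * j + 1"] that dims
          by (intro submatrix_index) simp_all
      qed
      then have "(\<Sum>q\<in>perfect_matchings h.
          of_int (sign q) * (\<Prod>j<h. A $$ (pick K (q (2 * j)), pick K (q (2 * j + 1)))))
        = (\<Sum>q\<in>perfect_matchings h.
          of_int (sign q) * (\<Prod>j<h. submatrix A K K $$ (q (2 * j), q (2 * j + 1))))"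
        by (intro sum.cong arg_cong2[where f = "(*)"] prod.cong refl) simp
      then show ?thesis unfolding Pf_def dim by simp
    qed
    finally show "(\<Sum>w | w \<in> W \<and> w ` {0..<n} = I. g w) = (- 1) ^ inv_pairs ({..<n + N} - I) I *
       Pf (submatrix A ({..<n + N} - I) ({..<n + N} - I)) * det (submatrix M UNIV I)"
      by (simp add: K_def mult.assoc)
  qed simp
  finally show ?thesis .
qed

subsection \<open>Laurent polynomials\<close>

lemma poly_mapping_sum_single: "p = (\<Sum>k\<in>Poly_Mapping.keys p. Poly_Mapping.single k (Poly_Mapping.lookup p k))"
  by (rule poly_mapping_eqI) (auto simp: lookup_sum lookup_single when_def in_keys_iff sum.delta)

lemma poly_mapping_single_induct [case_names zero single add]:
  assumes "P 0" "\<And>k c. P (Poly_Mapping.single k c)" "\<And>p q. P p \<Longrightarrow> P q \<Longrightarrow> P (p + q)"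
  shows "P (p :: 'b \<Rightarrow>\<^sub>0 'c::comm_monoid_add)"
proof -
  have "P (\<Sum>k\<in>S. Poly_Mapping.single k (Poly_Mapping.lookup p k))" for S
    by (induction S rule: infinite_finite_induct) (auto intro: assms)
  then show ?thesis using poly_mapping_sum_single[of p] by metis
qed

text \<open>Exponents form a group, so multiplication by a monomial merely translates the
  coefficient function. It suffices to check this when \<open>p\<close> is a monomial.\<close>

lemma lookup_mult_single:
  fixes p :: "'b::ab_group_add \<Rightarrow>\<^sub>0 'c::comm_ring_1"
  shows "Poly_Mapping.lookup (p * Poly_Mapping.single \<alpha> c) \<beta> = Poly_Mapping.lookup p (\<beta> - \<alpha>) * c"
proof (induction p rule: poly_mapping_single_induct)
  case (single k a)
  then show ?case by (auto simp: mult_single lookup_single when_def algebra_simps)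
qed (simp_all add: lookup_add distrib_right)

definition supported :: "'b set \<Rightarrow> ('b \<Rightarrow>\<^sub>0 'c::zero) \<Rightarrow> bool" where
  "supported M p \<longleftrightarrow> Poly_Mapping.keys p \<subseteq> M"

text \<open>A submonoid of the exponents; the elements supported on it form a subring. It is
  instantiated with the exponents in a given set of variables and with those of genuine polynomials
  in z_1, ..., z_n.\<close>

locale exponents =
  fixes M :: "'b::ab_group_add set"
  assumes zero_mem: "0 \<in> M" and add_mem: "\<alpha> \<in> M \<Longrightarrow> \<beta> \<in> M \<Longrightarrow> \<alpha> + \<beta> \<in> M"
begin

lemma supported_single: "\<alpha> \<in> M \<Longrightarrow> supported M (Poly_Mapping.single \<alpha> c)"
  by (simp add: supported_def)

lemma supported_0: "supported M 0" and supported_1: "supported M (1 :: 'b \<Rightarrow>\<^sub>0 'c::comm_ring_1)"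
  using supported_single[OF zero_mem, of "1 :: 'c"] by (simp_all add: supported_def)

lemma supported_add: "supported M p \<Longrightarrow> supported M q \<Longrightarrow> supported M (p + q)"
  unfolding supported_def using Poly_Mapping.keys_add[of p q] by blast

lemma supported_mult: "supported M p \<Longrightarrow> supported M q \<Longrightarrow> supported M (p * q)"
  for p q :: "'b \<Rightarrow>\<^sub>0 'c::comm_ring_1"
  unfolding supported_def using keys_mult[of p q] by (blast intro: add_mem)

lemma supported_sum: "(\<And>x. x \<in> S \<Longrightarrow> supported M (f x)) \<Longrightarrow> supported M (sum f S)"
  for f :: "_ \<Rightarrow> 'b \<Rightarrow>\<^sub>0 'c::comm_ring_1"
  by (induction S rule: infinite_finite_induct) (auto intro: supported_0 supported_add)

lemma supported_prod: "(\<And>x. x \<in> S \<Longrightarrow> supported M (f x)) \<Longrightarrow> supported M (prod f S)"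
  for f :: "_ \<Rightarrow> 'b \<Rightarrow>\<^sub>0 'c::comm_ring_1"
  by (induction S rule: infinite_finite_induct) (auto intro: supported_1 supported_mult)

lemma supported_minus_one_power: "supported M ((- 1) ^ k :: 'b \<Rightarrow>\<^sub>0 'c::comm_ring_1)"
  using supported_1 by (cases "even k") (simp_all add: supported_def keys_minus)

lemma supported_sign: "supported M (of_int (sign \<pi>) :: 'b \<Rightarrow>\<^sub>0 'c::comm_ring_1)"
  by (auto simp: sign_def intro: supported_1 supported_minus_one_power[of 1, simplified])

lemma supported_det:
  fixes X :: "('b \<Rightarrow>\<^sub>0 'c::comm_ring_1) mat"
  assumes "X \<in> carrier_mat n n" "\<And>i j. i < n \<Longrightarrow> j < n \<Longrightarrow> supported M (X $$ (i, j))"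
  shows "supported M (det X)"
  unfolding det_def'[OF assms(1)] using permutes_in_image
  by (intro supported_sum supported_mult supported_sign supported_prod assms(2)) fastforce+

text \<open>The recursion for index \<open>r\<close> uses only the nodes z_0, ..., z_r, sums and
  products.\<close>

lemma supported_newton_coeff:
  fixes z :: "nat \<Rightarrow> 'b \<Rightarrow>\<^sub>0 'c::comm_ring_1"
  assumes "\<And>i. i < n \<Longrightarrow> supported M (z i)"
  shows "r < n \<Longrightarrow> supported M (newton_coeff z r j)"
  by (induction j arbitrary: r)
    (auto intro!: supported_add supported_mult assms supported_0 supported_1 split: nat.split)

end

section \<open>Constant terms and separation of variables\<close>

lemma constant_term_add: "constant_term (p + q) = constant_term p + constant_term q"
  by (simp add: constant_term_def lookup_add)

lemma constant_term_sum: "constant_term (sum f S) = (\<Sum>x\<in>S. constant_term (f x))"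
  by (simp add: constant_term_def lookup_sum)

interpretation lconst: comm_ring_hom "lconst :: 'a::comm_ring_1 \<Rightarrow> 'a laurent"
  by unfold_locales (simp_all add: lconst_def single_add mult_single)

lemma constant_term_lconst_mult: "constant_term (lconst c * p) = c * constant_term p"
  using lookup_mult_single[of p 0 c 0] by (simp add: constant_term_def lconst_def mult.commute)

lemma zpow_mult: "zpow i a * zpow i b = (zpow i (a + b) :: 'a::comm_ring_1 laurent)"
  by (simp add: zpow_def mult_single single_add)

lemma zpow_0 [simp]: "zpow i 0 = 1"
  by (simp add: zpow_def)

lemma zpow_power: "zpow i a ^ k = (zpow i (int k * a) :: 'a::comm_ring_1 laurent)"
  by (induction k) (simp_all add: zpow_mult algebra_simps)

lemma constant_term_zpow: "constant_term (zpow i a) = (if a = 0 then 1 else 0)"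
proof -
  have "Poly_Mapping.single i a = 0 \<longleftrightarrow> a = 0"
    by (metis lookup_single_eq lookup_zero single_zero)
  then show ?thesis by (simp add: constant_term_def zpow_def lookup_single when_def)
qed

definition vars_in :: "nat set \<Rightarrow> (nat \<Rightarrow>\<^sub>0 int) set" where
  "vars_in V = {\<alpha>. Poly_Mapping.keys \<alpha> \<subseteq> V}"

interpretation vars_in: exponents "vars_in V"
  by unfold_locales (use keys_add in \<open>fastforce simp: vars_in_def\<close>)+

lemma supported_zpow: "i \<in> V \<Longrightarrow> supported (vars_in V) (zpow i a)"
  unfolding zpow_def by (rule vars_in.supported_single) (simp add: vars_in_def)

lemma supported_lconst: "supported (vars_in V) (lconst c)"
  unfolding lconst_def by (rule vars_in.supported_single) (simp add: vars_in_def)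

text \<open>A contribution to the constant term pairs an exponent \<beta> of \<open>q\<close> with
  -\<beta> of \<open>p\<close>. Its variables lie in both \<open>V\<close> and \<open>W\<close>,
  which forces \<beta> = 0.\<close>

lemma constant_term_mult_disjoint:
  assumes p: "supported (vars_in V) p" and q: "supported (vars_in W) q" and "V \<inter> W = {}"
  shows "constant_term (p * q) = constant_term p * (constant_term q :: 'a::comm_ring_1)"
proof -
  have "constant_term (p * q)
      = (\<Sum>\<beta>\<in>Poly_Mapping.keys q. Poly_Mapping.lookup p (- \<beta>) * Poly_Mapping.lookup q \<beta>)"
    by (subst poly_mapping_sum_single[of q])
      (simp add: constant_term_def sum_distrib_left lookup_sum lookup_mult_single)
  also have "\<dots> = (\<Sum>\<beta>\<in>Poly_Mapping.keys q. if \<beta> = 0 then constant_term p * constant_term q else 0)"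
  proof (rule sum.cong)
    fix \<beta> assume \<beta>: "\<beta> \<in> Poly_Mapping.keys q"
    have "\<beta> = 0" if "- \<beta> \<in> Poly_Mapping.keys p"
    proof -
      have "Poly_Mapping.keys (- \<beta>) \<subseteq> V" "Poly_Mapping.keys \<beta> \<subseteq> W"
        using that \<beta> p q by (auto simp only: supported_def vars_in_def)
      then show ?thesis using assms(3) unfolding keys_minus keys_eq_empty[symmetric] by blast
    qed
    then have "Poly_Mapping.lookup p (- \<beta>) = 0" if "\<beta> \<noteq> 0"
      using that unfolding in_keys_iff by blast
    then show "Poly_Mapping.lookup p (- \<beta>) * Poly_Mapping.lookup q \<beta>
        = (if \<beta> = 0 then constant_term p * constant_term q else 0)"
      by (simp add: constant_term_def)
  qed simp
  also have "\<dots> = constant_term p * constant_term q"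
    by (simp add: sum.delta constant_term_def in_keys_iff)
  finally show ?thesis .
qed

text \<open>One factor is split off at a time; injectivity of \<open>v\<close> keeps its variable
  apart from those of the other factors.\<close>

lemma constant_term_prod:
  assumes "finite S" "inj_on v S" "\<And>i. i \<in> S \<Longrightarrow> supported (vars_in {v i}) (f i)"
  shows "constant_term (\<Prod>i\<in>S. f i) = (\<Prod>i\<in>S. constant_term (f i) :: 'a::comm_ring_1)"
  using assms
proof (induction S rule: finite_induct)
  case empty
  then show ?case by (simp add: constant_term_def)
next
  case (insert i S)
  have mono: "supported (vars_in V) p \<Longrightarrow> V \<subseteq> W \<Longrightarrow> supported (vars_in W) p" for V W and p :: "'a laurent"
    by (auto simp: supported_def vars_in_def)
  have "supported (vars_in (v ` S)) (\<Prod>i\<in>S. f i)"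
    using insert.prems(2) by (intro vars_in.supported_prod) (rule mono, auto)
  then have "constant_term (f i * (\<Prod>i\<in>S. f i)) = constant_term (f i) * constant_term (\<Prod>i\<in>S. f i)"
    using insert by (intro constant_term_mult_disjoint[of "{v i}" _ "v ` S"]) auto
  then show ?case using insert by simp
qed

section \<open>Cancelling differences of variables\<close>

text \<open>The equation makes the coefficients of \<open>f\<close> invariant under translation of
  the exponent by e_j - e_i. A nonzero coefficient would thus recur at infinitely many exponents,
  against finite support. The argument is insensitive to zero divisors in the coefficient
  ring.\<close>

lemma mult_zvar_diff_eq_0:
  fixes f :: "'a::comm_ring_1 laurent"
  assumes "f * (zvar j - zvar i) = 0" "i \<noteq> j"
  shows "f = 0"
proof (rule poly_mapping_eqI)
  fix \<beta>
  let ?e = "\<lambda>i k. Poly_Mapping.single i k :: nat \<Rightarrow>\<^sub>0 int"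
  have eq: "Poly_Mapping.lookup f (\<beta> - ?e j 1) = Poly_Mapping.lookup f (\<beta> - ?e i 1)" for \<beta>
    using arg_cong[OF assms(1), of "\<lambda>f. Poly_Mapping.lookup f \<beta>"]
    by (simp add: right_diff_distrib lookup_minus zpow_def lookup_mult_single)
  have shift: "Poly_Mapping.lookup f (\<beta> + ?e j (int k) - ?e i (int k)) = Poly_Mapping.lookup f \<beta>" for k
  proof (induction k)
    case (Suc k)
    have "Poly_Mapping.lookup f (\<beta> + ?e j (int (Suc k)) - ?e i (int (Suc k)))
        = Poly_Mapping.lookup f ((\<beta> + ?e j (int k) + ?e j 1 - ?e i (int k)) - ?e i 1)"
      by (simp add: single_add algebra_simps)
    also have "\<dots> = Poly_Mapping.lookup f (\<beta> + ?e j (int k) - ?e i (int k))"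
      by (subst eq[symmetric]) (simp add: algebra_simps)
    finally show ?case using Suc.IH by simp
  qed simp
  show "Poly_Mapping.lookup f \<beta> = Poly_Mapping.lookup 0 \<beta>"
  proof (rule ccontr)
    assume "Poly_Mapping.lookup f \<beta> \<noteq> Poly_Mapping.lookup 0 \<beta>"
    then have "range (\<lambda>k. \<beta> + ?e j (int k) - ?e i (int k)) \<subseteq> Poly_Mapping.keys f"
      using shift by (auto simp: in_keys_iff)
    moreover have "inj (\<lambda>k. \<beta> + ?e j (int k) - ?e i (int k))"
    proof (rule injI)
      fix k l assume "\<beta> + ?e j (int k) - ?e i (int k) = \<beta> + ?e j (int l) - ?e i (int l)"
      from arg_cong[OF this, of "\<lambda>\<alpha>. Poly_Mapping.lookup \<alpha> j"] show "k = l"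
        using assms(2) by (simp add: lookup_add lookup_minus lookup_single_not_eq)
    qed
    ultimately show False
      using finite_subset[OF _ finite_keys] range_inj_infinite by blast
  qed
qed

lemma mult_prod_zvar_diff_eq_0:
  fixes f :: "'a::comm_ring_1 laurent"
  assumes "finite S" "\<And>i j. (i, j) \<in> S \<Longrightarrow> i \<noteq> j" "f * (\<Prod>(i, j)\<in>S. zvar j - zvar i) = 0"
  shows "f = 0"
  using assms
proof (induction S arbitrary: f rule: finite_induct)
  case (insert x S)
  obtain i j where x: "x = (i, j)" by (cases x)
  have "f * (zvar j - zvar i) * (\<Prod>(i, j)\<in>S. zvar j - zvar i) = 0"
    using insert by (simp add: x mult.assoc)
  then have "f * (zvar j - zvar i) = 0" using insert.IH insert.prems(1) by blast
  then show ?case using mult_zvar_diff_eq_0[of f j i] insert.prems(1)[of i j] x by simp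
qed simp

section \<open>Permuting the variables\<close>

text \<open>The substitution of z_{\<pi>(i)} for z_i: the inner \<open>map_key\<close> acts on
  exponent vectors, the outer one on coefficient functions. \<open>is_symmetric\<close> expresses
  invariance under it for all permutations of the variables.\<close>

definition perm_act :: "(nat \<Rightarrow> nat) \<Rightarrow> 'a::comm_ring_1 laurent \<Rightarrow> 'a laurent" where
  "perm_act \<pi> p = Poly_Mapping.map_key (Poly_Mapping.map_key \<pi>) p"

context
  fixes \<pi> :: "nat \<Rightarrow> nat"
  assumes bij: "bij \<pi>"
begin

lemma inj_inv_perm: "inj \<pi>" "inj (inv_into UNIV \<pi>)"
  using bij bij_imp_bij_inv bij_is_inj by auto

lemma map_key_inverse:
  "Poly_Mapping.map_key \<pi> (Poly_Mapping.map_key (inv_into UNIV \<pi>) \<alpha>) = (\<alpha> :: nat \<Rightarrow>\<^sub>0 int)"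
  "Poly_Mapping.map_key (inv_into UNIV \<pi>) (Poly_Mapping.map_key \<pi> \<alpha>) = (\<alpha> :: nat \<Rightarrow>\<^sub>0 int)"
proof -
  have eq: "\<pi> \<circ> inv_into UNIV \<pi> = (\<lambda>x. x)" "inv_into UNIV \<pi> \<circ> \<pi> = (\<lambda>x. x)"
    using bij by (simp_all add: fun_eq_iff bij_is_surj surj_f_inv_f inv_f_f[OF inj_inv_perm(1)])
  show "Poly_Mapping.map_key \<pi> (Poly_Mapping.map_key (inv_into UNIV \<pi>) \<alpha>) = \<alpha>"
    and "Poly_Mapping.map_key (inv_into UNIV \<pi>) (Poly_Mapping.map_key \<pi> \<alpha>) = \<alpha>"
    by (simp_all only: map_key_compose[OF inj_inv_perm] map_key_compose[OF inj_inv_perm(2,1)]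
        eq map_key_id)
qed

lemma inj_map_key: "inj (Poly_Mapping.map_key \<pi> :: (nat \<Rightarrow>\<^sub>0 int) \<Rightarrow> _)"
  by (rule inj_on_inverseI) (rule map_key_inverse(2))

lemma perm_act_single:
  "perm_act \<pi> (Poly_Mapping.single \<alpha> c) = Poly_Mapping.single (Poly_Mapping.map_key (inv_into UNIV \<pi>) \<alpha>) c"
  unfolding perm_act_def
  using map_key_single[OF inj_map_key, of "Poly_Mapping.map_key (inv_into UNIV \<pi>) \<alpha>" c]
  by (simp add: map_key_inverse)

lemma perm_act_add: "perm_act \<pi> (p + q) = perm_act \<pi> p + perm_act \<pi> q"
  unfolding perm_act_def by (rule map_key_plus[OF inj_map_key])

lemma perm_act_0: "perm_act \<pi> 0 = 0"
  unfolding perm_act_def by (rule map_key_zero[OF inj_map_key])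

lemma perm_act_mult: "perm_act \<pi> (p * q) = perm_act \<pi> p * perm_act \<pi> q"
proof (induction p rule: poly_mapping_single_induct)
  case (single k c)
  show ?case
  proof (induction q rule: poly_mapping_single_induct)
    case (single l d)
    then show ?case
      by (simp add: mult_single perm_act_single map_key_plus[OF inj_inv_perm(2)])
  qed (simp_all add: perm_act_0 perm_act_add distrib_left)
qed (simp_all add: perm_act_0 perm_act_add distrib_right)

lemma perm_act_lconst: "perm_act \<pi> (lconst c) = lconst c"
  by (simp add: lconst_def perm_act_single map_key_zero[OF inj_inv_perm(2)])

lemma comm_ring_hom_perm_act: "comm_ring_hom (perm_act \<pi> :: 'a::comm_ring_1 laurent \<Rightarrow> _)"
  using perm_act_lconst[of "1 :: 'a"]
  by unfold_locales (simp_all add: perm_act_0 perm_act_add perm_act_mult)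

lemma perm_act_zpow: "perm_act \<pi> (zpow i a) = zpow (\<pi> i) a"
  using map_key_single[OF inj_inv_perm(2), of "\<pi> i" a] inj_inv_perm(1)
  by (simp add: zpow_def perm_act_single)

lemma lookup_perm_act:
  "Poly_Mapping.lookup (perm_act \<pi> p) \<alpha> = Poly_Mapping.lookup p (Poly_Mapping.map_key \<pi> \<alpha>)"
  unfolding perm_act_def by (simp add: map_key.rep_eq[OF inj_map_key])

end

subsection \<open>The two sides of the identity\<close>

lemma (in comm_ring_hom) hom_Pf:
  assumes "X \<in> carrier_mat k k"
  shows "Pf (map_mat hom X) = hom (Pf X)"
proof (cases "odd k")
  case True
  then show ?thesis using assms by (simp add: Pf_def)
next
  case False
  then obtain h where k: "k = 2 * h" by (auto elim: evenE)
  have "map_mat hom X $$ (p (2 * i), p (2 * i + 1)) = hom (X $$ (p (2 * i), p (2 * i + 1)))"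
    if "p \<in> perfect_matchings h" "i < h" for p i
  proof -
    have p: "p permutes {0..<2 * h}" using that by (simp add: perfect_matchings_def)
    show ?thesis
      using permutes_in_image[OF p, of "2 * i"] permutes_in_image[OF p, of "2 * i + 1"] that assms k by simp
  qed
  then have "(\<Sum>p\<in>perfect_matchings h. of_int (sign p) * (\<Prod>i<h. map_mat hom X $$ (p (2 * i), p (2 * i + 1))))
      = (\<Sum>p\<in>perfect_matchings h. of_int (sign p) * (\<Prod>i<h. hom (X $$ (p (2 * i), p (2 * i + 1)))))"
    by (intro sum.cong arg_cong2[where f = "(*)"] prod.cong refl) simp
  then show ?thesis using assms k by (simp add: Pf_def hom_distribs)
qed

lemma submatrix_map_mat: "submatrix (map_mat f X) I J = map_mat f (submatrix X I J)"
  by (rule eq_matI) (simp_all add: submatrix_def pick_le)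

text \<open>Left multiplication by \<open>J_mat\<close> reverses the rows; with indices from 0, row
  i becomes row n - 1 - i.\<close>

lemma mult_J_mat:
  fixes X :: "'a::comm_ring_1 mat"
  assumes "X \<in> carrier_mat n c"
  shows "J_mat n * X = mat n c (\<lambda>(i, j). X $$ (n - 1 - i, j))"
proof (rule eq_matI)
  fix i j assume "i < dim_row (mat n c (\<lambda>(i, j). X $$ (n - 1 - i, j)))"
    "j < dim_col (mat n c (\<lambda>(i, j). X $$ (n - 1 - i, j)))"
  then have ij: "i < n" "j < c" by auto
  have "(J_mat n * X) $$ (i, j) = (\<Sum>k = 0..<n. (if i + 1 = n + 1 - (k + 1) then 1 else 0) * X $$ (k, j))"
    using ij assms by (simp add: J_mat_def scalar_prod_def)
  also have "\<dots> = (\<Sum>k = 0..<n. if k = n - 1 - i then X $$ (k, j) else 0)"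
    using ij by (intro sum.cong) auto
  finally show "(J_mat n * X) $$ (i, j) = mat n c (\<lambda>(i, j). X $$ (n - 1 - i, j)) $$ (i, j)"
    using ij by (simp add: sum.delta)
qed (use assms in \<open>auto simp: J_mat_def\<close>)

lemma J_mat_carrier [simp]: "J_mat n \<in> carrier_mat n n"
  by (simp add: J_mat_def)

text \<open>Reversing the rows twice is the identity. This lets the determinant of
  \<open>J_mat\<close> cancel in the end without its value being computed.\<close>

lemma det_J_mat_square: "det (J_mat n) * det (J_mat n) = (1 :: 'a::comm_ring_1)"
proof -
  have "J_mat n * J_mat n = (1\<^sub>m n :: 'a mat)"
    by (subst mult_J_mat[of _ n n]) (auto simp: J_mat_def intro!: eq_matI)
  then show ?thesis using det_mult[of "J_mat n :: 'a mat" n "J_mat n"] by simp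
qed

lemma det_J_mat_lconst: "lconst (det (J_mat n)) = det (J_mat n)"
proof -
  have "map_mat lconst (J_mat n) = (J_mat n :: 'a laurent mat)"
    by (rule eq_matI) (auto simp: J_mat_def)
  then show ?thesis by (metis lconst.hom_det)
qed

lemma submatrix_UNIV_cols:
  assumes "X \<in> carrier_mat n c" "I \<subseteq> {..<c}" "card I = n"
  shows "submatrix X UNIV I = mat n n (\<lambda>(i, j). X $$ (i, pick I j))"
proof -
  have "{j. j < c \<and> j \<in> I} = I" using assms(2) by auto
  then show ?thesis using assms(1,3) by (simp add: submatrix_def pick_UNIV)
qed

lemma pick_less_bound:
  assumes "I \<subseteq> {..<c}" "j < card I"
  shows "pick I j < c"
  using pick_in_set_le[OF assms(2)] assms(1) by auto

section \<open>Expansion of \<open>G_poly\<close> over sets of columns\<close>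

definition power_det :: "nat \<Rightarrow> (nat \<Rightarrow> nat) \<Rightarrow> 'a::comm_ring_1 laurent" where
  "power_det n f = det (mat n n (\<lambda>(i, j). zvar (i + 1) ^ f j))"

text \<open>The weight of a column set \<open>I\<close>, common to \<open>D_sum\<close> and to the
  expansion of \<open>G_poly\<close>.\<close>

definition pf_coeff :: "nat \<Rightarrow> 'a::comm_ring_1 mat \<Rightarrow> nat set \<Rightarrow> 'a" where
  "pf_coeff d A I = (- 1) ^ inv_pairs ({..<d} - I) I * Pf (submatrix A ({..<d} - I) ({..<d} - I))"

abbreviation pairs :: "nat \<Rightarrow> (nat \<times> nat) set" where
  "pairs n \<equiv> {(i, j). 1 \<le> i \<and> i < j \<and> j \<le> n}"

lemma finite_pairs: "finite (pairs n)"
  by (rule finite_subset[of _ "{..n} \<times> {..n}"]) auto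

lemma card_pairs: "card {(i, j). i < j \<and> j < n} = card (pairs n)"
proof (rule bij_betw_same_card[of "map_prod Suc Suc"])
  have "(i, j) \<in> map_prod Suc Suc ` {(i, j). i < j \<and> j < n}" if "(i, j) \<in> pairs n" for i j
    using that by (intro image_eqI[of _ _ "(i - 1, j - 1)"]) auto
  then show "bij_betw (map_prod Suc Suc) {(i, j). i < j \<and> j < n} (pairs n)"
    by (auto simp: bij_betw_def inj_on_def)
qed

lemma diff_prod_zvar:
  "diff_prod n (\<lambda>i. zvar (i + 1)) = (\<Prod>(i, j)\<in>pairs n. zvar j - zvar i :: 'a::comm_ring_1 laurent)"
proof -
  have "diff_prod n (\<lambda>i. zvar (i + 1)) = (\<Prod>(i, k)\<in>(SIGMA i:{..<n}. {..<i}). zvar (i + 1) - zvar (k + 1) :: 'a laurent)"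
    by (simp add: diff_prod_def prod.Sigma)
  also have "\<dots> = (\<Prod>(i, j)\<in>pairs n. zvar j - zvar i)"
    by (rule prod.reindex_bij_witness[of _ "\<lambda>(i, j). (j - 1, i - 1)" "\<lambda>(i, k). (k + 1, i + 1)"]) auto
  finally show ?thesis .
qed

text \<open>The zero block expansion is applied with \<open>J_mat n * T_mat n N\<close> as upper
  right block. Each of its minors is \<open>det (J_mat n)\<close> times a generalized Vandermonde
  determinant, whose exponents are the elements of \<open>I\<close> because columns are counted from
  0.\<close>

lemma G_poly_expansion:
  fixes A :: "'a::comm_ring_1 mat"
  assumes A: "A \<in> carrier_mat (n + N) (n + N)" and "even N"
  shows "G_poly n N A = lconst ((- 1) ^ card (pairs n) * det (J_mat n)) *
    (\<Sum>I | I \<subseteq> {..<n + N} \<and> card I = n. lconst (pf_coeff (n + N) A I) * power_det n (pick I))"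
proof -
  let ?T = "T_mat n N :: 'a laurent mat" and ?J = "J_mat n :: 'a laurent mat"
  have T: "?T \<in> carrier_mat n (n + N)" by (simp add: T_mat_def)
  have "G_poly n N A = (- 1) ^ card (pairs n) *
    (\<Sum>I | I \<subseteq> {..<n + N} \<and> card I = n. (- 1) ^ inv_pairs ({..<n + N} - I) I *
       Pf (submatrix (map_mat lconst A) ({..<n + N} - I) ({..<n + N} - I)) * det (submatrix (?J * ?T) UNIV I))"
    unfolding G_poly_def card_pairs[symmetric]
    by (rule Pf_four_block_zero) (use A T \<open>even N\<close> in \<open>auto intro!: mult_carrier_mat[of _ n n]\<close>)
  also have "\<dots> = (- 1) ^ card (pairs n) *
    (\<Sum>I | I \<subseteq> {..<n + N} \<and> card I = n. lconst (det (J_mat n)) * (lconst (pf_coeff (n + N) A I) * power_det n (pick I)))"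
  proof (rule arg_cong[where f = "(*) _"], rule sum.cong[OF refl])
    fix I assume "I \<in> {I. I \<subseteq> {..<n + N} \<and> card I = n}"
    then have I: "I \<subseteq> {..<n + N}" "card I = n" by auto
    let ?K = "{..<n + N} - I"
    have "submatrix ?T UNIV I = mat n n (\<lambda>(i, j). zvar (i + 1) ^ pick I j)"
      unfolding submatrix_UNIV_cols[OF T I]
      using pick_less_bound[OF I(1)] I(2) by (intro eq_matI) (auto simp: T_mat_def)
    \<comment> \<open>Selecting columns commutes with reversing rows.\<close>
    moreover have "submatrix (?J * ?T) UNIV I = ?J * submatrix ?T UNIV I"
    proof -
      have "?J * ?T \<in> carrier_mat n (n + N)" using T by (intro mult_carrier_mat[of _ n n]) auto
      then have "submatrix (?J * ?T) UNIV I = mat n n (\<lambda>(i, j). (?J * ?T) $$ (i, pick I j))"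
        by (rule submatrix_UNIV_cols) (use I in auto)
      also have "\<dots> = mat n n (\<lambda>(i, j). mat n n (\<lambda>(i, j). ?T $$ (i, pick I j)) $$ (n - 1 - i, j))"
        unfolding mult_J_mat[OF T] using pick_less_bound[OF I(1)] I(2) by (intro eq_matI) auto
      also have "\<dots> = ?J * submatrix ?T UNIV I"
        unfolding submatrix_UNIV_cols[OF T I] by (rule mult_J_mat[symmetric]) simp
      finally show ?thesis .
    qed
    ultimately have "det (submatrix (?J * ?T) UNIV I) = det ?J * power_det n (pick I)"
      using det_mult[of ?J n "submatrix ?T UNIV I"] by (simp add: power_det_def)
    moreover have "Pf (submatrix (map_mat lconst A) ?K ?K) = lconst (Pf (submatrix A ?K ?K))"
    proof -
      have "submatrix A ?K ?K \<in> carrier_mat (dim_row (submatrix A ?K ?K)) (dim_row (submatrix A ?K ?K))"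
        by (rule carrier_matI[OF refl]) (simp only: dim_submatrix carrier_matD[OF A])
      from lconst.hom_Pf[OF this] show ?thesis by (simp only: submatrix_map_mat)
    qed
    ultimately show "(- 1) ^ inv_pairs ?K I * Pf (submatrix (map_mat lconst A) ?K ?K) * det (submatrix (?J * ?T) UNIV I)
        = lconst (det (J_mat n)) * (lconst (pf_coeff (n + N) A I) * power_det n (pick I))"
      by (simp only: pf_coeff_def det_J_mat_lconst lconst.hom_mult lconst.hom_power
          lconst.hom_uminus lconst.hom_one mult_ac)
  qed
  also have "\<dots> = lconst ((- 1) ^ card (pairs n) * det (J_mat n)) *
    (\<Sum>I | I \<subseteq> {..<n + N} \<and> card I = n. lconst (pf_coeff (n + N) A I) * power_det n (pick I))"
    by (simp add: sum_distrib_left[symmetric] lconst.hom_mult lconst.hom_power lconst.hom_uminus mult.assoc)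
  finally show ?thesis .
qed

section \<open>Existence, uniqueness and symmetry of the quotient\<close>

definition polynomial_exponents :: "nat \<Rightarrow> (nat \<Rightarrow>\<^sub>0 int) set" where
  "polynomial_exponents n = {\<alpha>. Poly_Mapping.keys \<alpha> \<subseteq> {1..n} \<and> (\<forall>i. Poly_Mapping.lookup \<alpha> i \<ge> 0)}"

interpretation polynomial_exponents: exponents "polynomial_exponents n"
proof
  fix \<alpha> \<beta> assume "\<alpha> \<in> polynomial_exponents n" "\<beta> \<in> polynomial_exponents n"
  then show "\<alpha> + \<beta> \<in> polynomial_exponents n"
    using Poly_Mapping.keys_add[of \<alpha> \<beta>] by (auto simp: polynomial_exponents_def lookup_add)
qed (simp add: polynomial_exponents_def)

lemma is_polynomial_iff: "is_polynomial n p \<longleftrightarrow> supported (polynomial_exponents n) p"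
  by (auto simp: is_polynomial_def supported_def polynomial_exponents_def)

text \<open>Permuting the variables permutes the rows, so \<open>s\<close> is a sign. What matters
  is that one \<open>s\<close> serves all exponent functions \<open>f\<close>, and so the product of
  differences as well.\<close>

lemma perm_act_power_det:
  assumes \<pi>: "\<pi> permutes {1..n}"
  obtains s :: "'a::comm_ring_1 laurent" where "s * s = 1" "\<And>f. perm_act \<pi> (power_det n f) = s * power_det n f"
proof
  \<comment> \<open>The permutation \<open>\<pi>\<close> transported from the variables 1, ..., n to
    the row indices 0, ..., n - 1.\<close>
  define \<rho> where "\<rho> i = (if i < n then \<pi> (i + 1) - 1 else i)" for i
  have range: "1 \<le> \<pi> (Suc i) \<and> \<pi> (Suc i) \<le> n" if "i < n" for i
    using permutes_in_image[OF \<pi>, of "Suc i"] that by simp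
  have \<rho>: "\<rho> permutes {0..<n}"
  proof (rule inj_imp_permutes)
    show "inj_on \<rho> {0..<n}"
    proof (rule inj_onI)
      fix i j assume "i \<in> {0..<n}" "j \<in> {0..<n}" "\<rho> i = \<rho> j"
      then have "\<pi> (Suc i) - 1 = \<pi> (Suc j) - 1" "i < n" "j < n" by (simp_all add: \<rho>_def)
      then have "\<pi> (Suc i) = \<pi> (Suc j)" using range[of i] range[of j] by linarith
      then show "i = j" using inj_eq[OF permutes_inj[OF \<pi>]] by simp
    qed
    show "\<rho> i \<in> {0..<n}" if "i \<in> {0..<n}" for i
      using that range[of i] by (auto simp: \<rho>_def)
  qed (auto simp: \<rho>_def)
  let ?s = "of_int (sign \<rho>) :: 'a laurent"
  show "?s * ?s = 1" by (simp add: sign_def)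
  interpret act: comm_ring_hom "perm_act \<pi> :: 'a laurent \<Rightarrow> _"
    by (rule comm_ring_hom_perm_act[OF permutes_bij[OF \<pi>]])
  show "perm_act \<pi> (power_det n f) = ?s * power_det n f" for f
  proof -
    let ?X = "mat n n (\<lambda>(i, j). zvar (i + 1) ^ f j :: 'a laurent)"
    have "map_mat (perm_act \<pi>) ?X = mat n n (\<lambda>(i, j). ?X $$ (\<rho> i, j))"
    proof (rule eq_matI)
      fix i j assume "i < dim_row (mat n n (\<lambda>(i, j). ?X $$ (\<rho> i, j)))"
        "j < dim_col (mat n n (\<lambda>(i, j). ?X $$ (\<rho> i, j)))"
      then have ij: "i < n" "j < n" by auto
      have "Suc (\<rho> i) = \<pi> (Suc i)" using range[OF ij(1)] ij by (simp add: \<rho>_def)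
      moreover have "\<rho> i < n" using permutes_in_image[OF \<rho>, of i] ij by simp
      ultimately show "map_mat (perm_act \<pi>) ?X $$ (i, j) = mat n n (\<lambda>(i, j). ?X $$ (\<rho> i, j)) $$ (i, j)"
        using ij by (simp add: act.hom_power perm_act_zpow[OF permutes_bij[OF \<pi>]])
    qed auto
    then show ?thesis
      unfolding power_det_def act.hom_det[symmetric] by (simp add: det_permute_rows[OF _ \<rho>])
  qed
qed

text \<open>The definite description is discharged by an explicit witness. The product of
  differences can be cancelled, which gives uniqueness, and also symmetry once \<open>G_poly\<close>
  and this product are seen to change by the same sign.\<close>

lemma F_poly_times_differences:
  fixes A :: "'a::comm_ring_1 mat"
  assumes A: "A \<in> carrier_mat (n + N) (n + N)" and "even N"
  shows "F_poly n N A * (\<Prod>(i, j)\<in>pairs n. zvar j - zvar i) = G_poly n N A"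
proof -
  let ?\<Delta> = "\<Prod>(i, j)\<in>pairs n. zvar j - zvar i :: 'a laurent"
  let ?z = "\<lambda>i. zvar (i + 1) :: 'a laurent"
  let ?P = "\<lambda>F. is_polynomial n F \<and> is_symmetric n F \<and> G_poly n N A = F * ?\<Delta>"
  let ?c = "(- 1) ^ card (pairs n) * det (J_mat n) :: 'a"
  let ?H = "\<lambda>I. mat n n (\<lambda>(r, j). newton_coeff ?z r (pick I j))"
  \<comment> \<open>The expansion of \<open>G_poly\<close> with each generalized Vandermonde
    determinant replaced by its Newton quotient.\<close>
  define F where "F = lconst ?c *
    (\<Sum>I | I \<subseteq> {..<n + N} \<and> card I = n. lconst (pf_coeff (n + N) A I) * det (?H I))"
  have cancel: "f = g" if "f * ?\<Delta> = g * ?\<Delta>" for f g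
    using that mult_prod_zvar_diff_eq_0[OF finite_pairs, of n "f - g"] by (auto simp: left_diff_distrib)
  have G: "G_poly n N A = F * ?\<Delta>"
    unfolding G_poly_expansion[OF assms] F_def power_det_def det_powers diff_prod_zvar
    by (simp add: sum_distrib_left sum_distrib_right mult_ac)
  have "is_polynomial n F"
  proof -
    have "supported (polynomial_exponents n) (lconst c)" for c :: 'a
      unfolding lconst_def
      by (rule polynomial_exponents.supported_single) (rule polynomial_exponents.zero_mem)
    moreover have z: "supported (polynomial_exponents n) (?z i)" if "i < n" for i
      unfolding zpow_def using that
      by (intro polynomial_exponents.supported_single) (auto simp: polynomial_exponents_def lookup_single when_def)
    moreover have "supported (polynomial_exponents n) (newton_coeff ?z r j)" if "r < n" for r j
      by (rule polynomial_exponents.supported_newton_coeff[OF z that])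
    ultimately show ?thesis
      unfolding is_polynomial_iff F_def
      by (intro polynomial_exponents.supported_mult polynomial_exponents.supported_sum
          polynomial_exponents.supported_det[of _ n]) auto
  qed
  moreover have "is_symmetric n F"
    unfolding is_symmetric_def
  proof (intro allI impI)
    fix \<pi> \<alpha> assume \<pi>: "\<pi> permutes {1..n}"
    note bij = permutes_bij[OF \<pi>]
    interpret act: comm_ring_hom "perm_act \<pi> :: 'a laurent \<Rightarrow> _"
      by (rule comm_ring_hom_perm_act[OF bij])
    obtain s :: "'a laurent" where s: "s * s = 1" "\<And>f. perm_act \<pi> (power_det n f) = s * power_det n f"
      using perm_act_power_det[OF \<pi>] by metis
    \<comment> \<open>The product of differences is the generalized Vandermonde determinant with
      exponents 0, ..., n - 1, so it changes by the same \<open>s\<close>.\<close>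
    have \<Delta>: "?\<Delta> = power_det n (\<lambda>j. j)"
      unfolding power_det_def det_vandermonde diff_prod_zvar ..
    have "perm_act \<pi> (G_poly n N A) = s * G_poly n N A"
      unfolding G_poly_expansion[OF assms]
      by (simp add: act.hom_mult act.hom_sum s(2) perm_act_lconst[OF bij] sum_distrib_left mult_ac)
    then have eq: "perm_act \<pi> F * (s * ?\<Delta>) = s * (F * ?\<Delta>)"
      unfolding G act.hom_mult \<Delta> s(2) .
    have "(s * s) * (perm_act \<pi> F * ?\<Delta>) = s * (perm_act \<pi> F * (s * ?\<Delta>))"
      by (simp only: mult_ac)
    also have "\<dots> = (s * s) * (F * ?\<Delta>)" unfolding eq by (simp only: mult.assoc)
    finally have "perm_act \<pi> F * ?\<Delta> = F * ?\<Delta>" by (simp only: s(1) mult_1_left)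
    then have "perm_act \<pi> F = F" by (rule cancel)
    then show "Poly_Mapping.lookup F (Poly_Mapping.map_key \<pi> \<alpha>) = Poly_Mapping.lookup F \<alpha>"
      using lookup_perm_act[OF bij, of F \<alpha>] by simp
  qed
  ultimately have "?P F" using G by simp
  moreover have "F' = F" if "?P F'" for F'
    by (rule cancel) (use that G in argo)
  ultimately have "F_poly n N A = F" unfolding F_poly_def by (rule the_equality)
  then show ?thesis using G by simp
qed

section \<open>Constant terms and the entries of \<open>B_mat\<close>\<close>

text \<open>Pascal's rule, valid for every integer \<open>x\<close> because \<open>binom\<close>
  vanishes at negative lower arguments; the induction needs \<open>x\<close> to vary.\<close>

lemma constant_term_binomial:
  "constant_term (zpow k x * (1 + zinv k) ^ r) = (binom r x :: 'a::comm_ring_1)"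
proof (induction r arbitrary: x)
  case 0
  then show ?case
    by (cases "x > 0") (auto simp: constant_term_zpow binom_def binomial_eq_0)
next
  case (Suc r)
  have "zpow k x * (1 + zinv k) ^ Suc r
      = zpow k x * (1 + zinv k) ^ r + zpow k (x - 1) * (1 + zinv k :: 'a laurent) ^ r"
    using zpow_mult[of k x "- 1", symmetric, where 'a = 'a] by (simp add: algebra_simps)
  moreover have "binom (Suc r) x = (binom r x + binom r (x - 1) :: 'a)"
  proof (cases "x > 0")
    case True
    then obtain y where "nat x = Suc y" "nat (x - 1) = y" by (cases "nat x") auto
    then show ?thesis using True by (simp add: binom_def)
  qed (auto simp: binom_def)
  ultimately show ?case by (simp add: constant_term_add Suc.IH)
qed

text \<open>Entry (d, e) of \<open>B_mat\<close> is the coefficient of z^(e - d) in h_d(z).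
  Expanding the factors 1 + t/z and 1 + u/z reduces this to binomials, each factor 1/z lowering the
  lower argument by one.\<close>

lemma constant_term_h_factor:
  fixes t u :: "'a::comm_ring_1"
  shows "constant_term (zpow k (- int d) * h_factor m d (zinv k) (lconst t) (lconst u) * zvar k ^ e)
    = b_entry m t u d e"
proof -
  define x where "x = int e - int d"
  have x: "zpow k (- int d) * h * zvar k ^ e = zpow k x * h" for h :: "'a laurent"
    using zpow_mult[of k "- int d" "int e", where 'a = 'a] by (simp add: zpow_power x_def mult_ac)
  have shift: "zpow k y * (zinv k * h) = zpow k (y - 1) * h" for y and h :: "'a laurent"
    using zpow_mult[of k y "- 1", where 'a = 'a] by (simp add: mult.assoc[symmetric])
  consider "d + m = 0" | "d + m = 1" | "d + m \<ge> 2" by linarith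
  then show ?thesis
  proof cases
    case 1
    then show ?thesis
      unfolding x using constant_term_zpow[of k x, where 'a = 'a]
      by (simp add: h_factor_def b_entry_def x_def)
  next
    case 2
    \<comment> \<open>The trivial power \<open>(1 + zinv k) ^ 0\<close> is inserted to match
      \<open>constant_term_binomial\<close>; here the upper argument d + m - 1 in
      \<open>b_entry\<close> is 0.\<close>
    have "zpow k x * (1 + lconst t * lconst u * zinv k)
        = zpow k x * (1 + zinv k) ^ 0 + lconst (t * u) * (zpow k (x - 1) * (1 + zinv k) ^ 0)"
      using shift[of x 1] by (simp add: algebra_simps lconst.hom_mult)
    then have "constant_term (zpow k x * (1 + lconst t * lconst u * zinv k))
        = binom 0 x + t * u * binom 0 (x - 1)"
      by (simp only: constant_term_add constant_term_lconst_mult constant_term_binomial)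
    then show ?thesis
      unfolding x using 2 by (simp add: h_factor_def b_entry_def x_def add.commute[of m] mult_ac)
  next
    case 3
    let ?h = "(1 + zinv k :: 'a laurent) ^ (d + m - 2)"
    have "zpow k x * (?h * (1 + lconst t * zinv k) * (1 + lconst u * zinv k))
        = zpow k x * ?h + lconst (t + u) * (zpow k (x - 1) * ?h)
          + lconst (t * u) * (zpow k (x - 1 - 1) * ?h)"
      unfolding shift[symmetric] by (simp add: algebra_simps lconst.hom_mult lconst.hom_add)
    then have "constant_term (zpow k x * (?h * (1 + lconst t * zinv k) * (1 + lconst u * zinv k)))
        = binom (d + m - 2) x + (t + u) * binom (d + m - 2) (x - 1) + t * u * binom (d + m - 2) (x - 1 - 1)"
      by (simp only: constant_term_add constant_term_lconst_mult constant_term_binomial)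
    then show ?thesis
      unfolding x using 3 by (auto simp add: h_factor_def b_entry_def x_def add.commute[of m] mult_ac)
  qed
qed

lemma supported_h_factor:
  "supported (vars_in {k}) (h_factor m d (zinv k) (lconst t) (lconst u))"
proof -
  have power: "supported (vars_in {k}) (p ^ r)" if "supported (vars_in {k}) p" for p :: "'a laurent" and r
    using that by (induction r) (auto intro: vars_in.supported_1 vars_in.supported_mult)
  show ?thesis
    unfolding h_factor_def
    by (auto intro!: power vars_in.supported_1 vars_in.supported_mult vars_in.supported_add
        supported_zpow supported_lconst)
qed

text \<open>In each Leibniz term the factor for row i involves only the variable z_{i+1}, so the
  constant term is a product of entries of \<open>B_mat\<close>. That variable comes with h_{n-1-i},
  so the rows appear in reverse order.\<close>

lemma constant_term_power_det:
  fixes t u :: "'a::comm_ring_1"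
  shows "constant_term ((\<Prod>k = 1..n. zpow k (- int (n - k)) * h_factor m (n - k) (zinv k) (lconst t) (lconst u))
      * power_det n f) = det (mat n n (\<lambda>(i, j). b_entry m t u (n - 1 - i) (f j)))"
proof -
  let ?w = "\<lambda>k. zpow k (- int (n - k)) * h_factor m (n - k) (zinv k) (lconst t) (lconst u) :: 'a laurent"
  let ?Perm = "{\<sigma>. \<sigma> permutes {0..<n}}"
  have W: "(\<Prod>k = 1..n. ?w k) = (\<Prod>i = 0..<n. ?w (Suc i))"
    by (rule prod.reindex_bij_witness[of _ Suc "\<lambda>k. k - 1"]) auto
  have "power_det n f = (\<Sum>\<sigma>\<in>?Perm. of_int (sign \<sigma>) * (\<Prod>i = 0..<n. zvar (Suc i) ^ f (\<sigma> i)) :: 'a laurent)"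
    unfolding power_det_def det_def'[OF mat_carrier]
    by (intro sum.cong arg_cong2[where f = "(*)"] prod.cong refl)
      (use permutes_in_image in \<open>fastforce\<close>)
  then have "(\<Prod>k = 1..n. ?w k) * power_det n f
      = (\<Sum>\<sigma>\<in>?Perm. lconst (of_int (sign \<sigma>)) * (\<Prod>i = 0..<n. ?w (Suc i) * zvar (Suc i) ^ f (\<sigma> i)))"
    unfolding W by (simp only: prod.distrib[of "\<lambda>i. ?w (Suc i)"] sum_distrib_left lconst.hom_of_int mult.left_commute)
  then have "constant_term ((\<Prod>k = 1..n. ?w k) * power_det n f)
      = (\<Sum>\<sigma>\<in>?Perm. of_int (sign \<sigma>) * constant_term (\<Prod>i = 0..<n. ?w (Suc i) * zvar (Suc i) ^ f (\<sigma> i)))"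
    by (simp only: constant_term_sum constant_term_lconst_mult)
  also have "\<dots> = (\<Sum>\<sigma>\<in>?Perm. of_int (sign \<sigma>) *
      (\<Prod>i = 0..<n. constant_term (?w (Suc i) * zvar (Suc i) ^ f (\<sigma> i))))"
    by (intro sum.cong arg_cong2[where f = "(*)"] refl constant_term_prod[of _ Suc])
      (auto simp: zpow_power intro!: vars_in.supported_mult supported_zpow supported_h_factor)
  also have "\<dots> = (\<Sum>\<sigma>\<in>?Perm. of_int (sign \<sigma>) * (\<Prod>i = 0..<n. b_entry m t u (n - 1 - i) (f (\<sigma> i))))"
    by (simp only: constant_term_h_factor diff_diff_left plus_1_eq_Suc)
  also have "\<dots> = det (mat n n (\<lambda>(i, j). b_entry m t u (n - 1 - i) (f j)))"
    unfolding det_def'[OF mat_carrier]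
    by (intro sum.cong arg_cong2[where f = "(*)"] prod.cong refl)
      (use permutes_in_image in \<open>fastforce\<close>)
  finally show ?thesis .
qed

text \<open>Each factor is -(z_j - z_i) / z_i, and z_i occurs as a denominator once for every j with
  i < j \<le> n, that is, n - i times.\<close>

lemma prod_one_minus_quotient:
  "(\<Prod>(i, j)\<in>pairs n. 1 - zvar j * zinv i) =
    (- 1) ^ card (pairs n) * (\<Prod>(i, j)\<in>pairs n. zvar j - zvar i) *
    (\<Prod>k = 1..n. zpow k (- int (n - k)) :: 'a::comm_ring_1 laurent)"
proof -
  have "(\<Prod>(i, j)\<in>pairs n. 1 - zvar j * zinv i :: 'a laurent)
      = (\<Prod>x\<in>pairs n. (- 1) * (zvar (snd x) - zvar (fst x)) * zinv (fst x))"
    using zpow_mult[of _ 1 "- 1", where 'a = 'a] by (intro prod.cong) (auto simp: algebra_simps)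
  also have "\<dots> = (- 1) ^ card (pairs n) * (\<Prod>(i, j)\<in>pairs n. zvar j - zvar i) * (\<Prod>(i, j)\<in>pairs n. zinv i)"
    by (simp only: prod.distrib prod_constant case_prod_unfold)
  also have "(\<Prod>(i, j)\<in>pairs n. zinv i) = (\<Prod>k = 1..n. zpow k (- int (n - k)) :: 'a laurent)"
  proof -
    have eq: "pairs n = (SIGMA i:{1..n}. {i<..n})" by auto
    have "(\<Prod>(i, j)\<in>pairs n. zinv i :: 'a laurent) = (\<Prod>i = 1..n. \<Prod>j\<in>{i<..n}. zinv i)"
      unfolding eq by (rule prod.Sigma[symmetric]) auto
    then show ?thesis by (simp add: zpow_power)
  qed
  finally show ?thesis .
qed

theorem theorem8p1:
  fixes A :: "'a::comm_ring_1 mat" and t u :: 'a and m n N :: nat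
  assumes "n \<ge> 1"
    and "even N"
    and "N \<ge> n + m - 1"
    and "A \<in> carrier_mat (n + N) (n + N)"
    and "transpose_mat A = - A"
  shows "D_sum N n m A t u = C_term N n m A t u"
proof -
  let ?s = "(- 1) ^ card (pairs n)" and ?dJ = "det (J_mat n) :: 'a"
  let ?\<Delta> = "\<Prod>(i, j)\<in>pairs n. zvar j - zvar i :: 'a laurent"
  let ?h = "\<lambda>k. h_factor m (n - k) (zinv k) (lconst t) (lconst u) :: 'a laurent"
  let ?w = "\<Prod>k = 1..n. zpow k (- int (n - k)) * ?h k"
  let ?S = "{I. I \<subseteq> {..<n + N} \<and> card I = n}"
  have ss: "?s * ?s = (1 :: 'a)" by (simp flip: power_mult_distrib)
  have "C_term N n m A t u
      = constant_term (((?s * ?\<Delta> * (\<Prod>k = 1..n. zpow k (- int (n - k)))) * (\<Prod>k = 1..n. ?h k)) * F_poly n N A)"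
    by (simp only: C_term_def prod_one_minus_quotient)
  \<comment> \<open>The product of differences combines with \<open>F_poly\<close> to
    \<open>G_poly\<close>; what remains is a product of functions of one variable each.\<close>
  also have "\<dots> = constant_term (?s * (?w * G_poly n N A))"
    unfolding F_poly_times_differences[OF assms(4,2), symmetric] prod.distrib by (simp only: mult_ac)
  also have "?s * (?w * G_poly n N A)
      = (\<Sum>I\<in>?S. lconst (?s * (?s * ?dJ) * pf_coeff (n + N) A I) * (?w * power_det n (pick I)))"
    unfolding G_poly_expansion[OF assms(4,2)]
    by (simp only: sum_distrib_left lconst.hom_mult lconst.hom_power lconst.hom_uminus lconst.hom_one mult_ac)
  \<comment> \<open>One sign \<open>?s\<close> comes from rewriting the factors 1 - z_j / z_i, the
    other from the interleaving in \<open>G_poly\<close>; their product is 1.\<close>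
  also have "constant_term \<dots> = (\<Sum>I\<in>?S. ?dJ * pf_coeff (n + N) A I *
      det (mat n n (\<lambda>(i, j). b_entry m t u (n - 1 - i) (pick I j))))"
    by (simp only: constant_term_sum constant_term_lconst_mult constant_term_power_det)
      (simp only: mult.assoc[symmetric] ss mult_1)
  also have "\<dots> = (\<Sum>I\<in>?S. pf_coeff (n + N) A I * det (submatrix (B_mat N n m t u) UNIV I))"
  proof (rule sum.cong)
    fix I assume "I \<in> ?S"
    then have I: "I \<subseteq> {..<n + N}" "card I = n" by auto
    have "B_mat N n m t u \<in> carrier_mat n (n + N)" by (simp add: B_mat_def)
    from submatrix_UNIV_cols[OF this I] have B: "submatrix (B_mat N n m t u) UNIV I = mat n n (\<lambda>(i, j). b_entry m t u i (pick I j))"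
      by (rule trans) (rule eq_matI, use pick_less_bound[OF I(1)] I(2) in \<open>auto simp: B_mat_def\<close>)
    \<comment> \<open>The reversed rows contribute a second \<open>det (J_mat n)\<close>, which
      cancels the one from \<open>G_poly\<close>.\<close>
    have "mat n n (\<lambda>(i, j). b_entry m t u (n - 1 - i) (pick I j)) = J_mat n * submatrix (B_mat N n m t u) UNIV I"
      unfolding B by (subst mult_J_mat[OF mat_carrier]) (auto intro!: eq_matI)
    then have "det (mat n n (\<lambda>(i, j). b_entry m t u (n - 1 - i) (pick I j)))
        = ?dJ * det (submatrix (B_mat N n m t u) UNIV I)"
      using det_mult[of "J_mat n :: 'a mat" n "submatrix (B_mat N n m t u) UNIV I"] by (simp add: B)
    then show "?dJ * pf_coeff (n + N) A I * det (mat n n (\<lambda>(i, j). b_entry m t u (n - 1 - i) (pick I j)))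
        = pf_coeff (n + N) A I * det (submatrix (B_mat N n m t u) UNIV I)"
      using det_J_mat_square[of n, where 'a = 'a] by (simp add: mult_ac) (metis mult.assoc mult_1)
  qed simp
  also have "\<dots> = D_sum N n m A t u"
    by (simp add: D_sum_def pf_coeff_def)
  finally show ?thesis by simp
qed

end
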